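(* Let $n\ge1$ and let $f:\mathbb R^n\to\mathbb R$ be a continuous function which has continuous derivatives, such that, for all $x\in\mathbb R^n$, $w\in S_n$, $r\in\mathbb Z^n$ and $i=1,\dots,n$, $$f(wx+r)=(\det w)f(x),\qquad f(\varepsilon_ix)=-f(x),$$ and such that $f$ vanishes on the boundary of $F$. Then $f$ can be expanded in the functions $\sin^-_m$, $m\in P^+_+$: $$f(x)=\sum_{m\in P^+_+}c_m\,\sin^-_m(x),$$ where the coefficients are given by $$c_m=2^{2n}\int_{\overline F}f(x)\,\sin^-_m(x)\,dx .$$ Moreover, the Plancherel formula holds: $$\sum_{m\in P^+_+}|c_m|^2=2^{2n}\int_{\overline F}|f(x)|^2dx .$$
   Context: The symmetric group $S_n$ acts on $\mathbb R^n$ by permuting coordinates, $\det w=\pm1$ is the sign of $w$, and $\varepsilon_i$ changes the sign of the coordinate $x_i$. $F=\{x\in\mathbb R^n:\tfrac12>x_1>x_2>\cdots>x_n>0\}$ with closure $\overline F$. $P^+_+=\{m\in\mathbb Z^n: m_1>m_2>\cdots>m_n>0\}$. $\sin^-_m(x)=\det(\sin2\pi m_ix_j)_{i,j=1}^n$. *)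

theory Defs
  imports "HOL-Analysis.Analysis"
begin

text \<open>
  The dimension is \<open>n = CARD('n)\<close>; the linear order on the index type \<open>'n\<close> identifies it
  with \<open>{1, ..., n}\<close>.
\<close>

definition fund_domain :: "(real ^ 'n::{finite,linorder}) set" where
  "fund_domain = {x. (\<forall>i. 0 < x $ i \<and> x $ i < 1/2) \<and> (\<forall>i j. i < j \<longrightarrow> x $ i > x $ j)}"

definition P_plus :: "(int ^ 'n::{finite,linorder}) set" where
  "P_plus = {m. (\<forall>i. 0 < m $ i) \<and> (\<forall>i j. i < j \<longrightarrow> m $ i > m $ j)}"

definition perm_act :: "('n \<Rightarrow> 'n) \<Rightarrow> real ^ 'n \<Rightarrow> real ^ 'n::finite" where
  "perm_act w x = (\<chi> i. x $ w i)"

definition flip_coord :: "'n \<Rightarrow> real ^ 'n \<Rightarrow> real ^ 'n::finite" where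
  "flip_coord i x = (\<chi> j. if j = i then - (x $ j) else x $ j)"

definition int_vec :: "int ^ 'n \<Rightarrow> real ^ 'n::finite" where
  "int_vec r = (\<chi> i. real_of_int (r $ i))"

definition sin_minus :: "int ^ 'n \<Rightarrow> real ^ 'n \<Rightarrow> real" where
  "sin_minus m x = det (\<chi> i j. sin (2 * pi * real_of_int (m $ i) * x $ j) :: real ^ 'n ^ 'n::finite)"

definition continuous_partial_derivs :: "(real ^ 'n::finite \<Rightarrow> real) \<Rightarrow> bool" where
  "continuous_partial_derivs f \<longleftrightarrow>
     (\<forall>i. \<exists>D. continuous_on UNIV D \<and>
        (\<forall>x. ((\<lambda>t. f (x + t *\<^sub>R axis i 1)) has_real_derivative D x) (at 0)))"

definition sin_minus_coeff :: "(real ^ 'n::{finite,linorder} \<Rightarrow> real) \<Rightarrow> int ^ 'n::{finite,linorder} \<Rightarrow> real" where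
  "sin_minus_coeff f m =
     2 ^ (2 * CARD('n)) * (LINT x:closure fund_domain|lborel. f x * sin_minus m x)"

text \<open>
  The series over \<open>P_plus\<close> is summed as a multiple Fourier series, through its cubical partial
  sums \<open>m\<^sub>1, ..., m\<^sub>n \<le> N\<close> (finitely many terms, as all entries are positive). Unordered
  (absolute) convergence is not available for \<open>C\<^sup>1\<close> functions of several variables; it fails in
  general for \<open>n \<ge> 3\<close>.
\<close>

definition sin_minus_partial_sum ::
    "(real ^ 'n::{finite,linorder} \<Rightarrow> real) \<Rightarrow> nat \<Rightarrow> real ^ 'n::{finite,linorder} \<Rightarrow> real" where
  "sin_minus_partial_sum f N x =
     (\<Sum>m\<in>{m\<in>P_plus. \<forall>i. m $ i \<le> int N}. sin_minus_coeff f m * sin_minus m x)"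

end

theory Submission
  imports Defs "HOL-Real_Asymp.Real_Asymp"
begin

text \<open>
  Since \<open>f\<close> and \<open>sin_minus m\<close> change by the same sign under permutations of the coordinates,
  and the cube \<open>[0, 1/2]\<^sup>n\<close> is up to a null set the disjoint union of the images of the
  fundamental domain, the cubical partial sums are those of the multiple sine series of \<open>f\<close>:
  they arise from \<open>f\<close> by applying a one-dimensional sine partial sum in each coordinate.
  In one dimension, integration by parts against the Fourier remainder of the sawtooth function, whose
  \<open>L\<^sup>2\<close> norm is the square root of a tail of \<open>\<Sum>1/k\<^sup>2\<close>, bounds the error of the \<open>N\<close>-th partial sum
  of a \<open>C\<^sup>1\<close> function by \<open>M / sqrt N\<close>. Passing from one coordinate to \<open>n\<close> coordinates costs
  powers of the Lebesgue constant, which is \<open>O(ln N)\<close>, so the partial sums converge uniformly.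
  Plancherel then follows by integrating \<open>f\<close> against its partial sums; orthogonality
  of the \<open>sin_minus m\<close> is not needed.
\<close>

subsection \<open>Dirichlet kernel\<close>

text \<open>Jordan's inequality: sine is concave on [0, pi], so it lies above its chord from 0 to
  pi/2.\<close>

lemma sin_pi_ge:
  fixes t :: real
  assumes "0 \<le> t" "t \<le> 1/2"
  shows "2 * t \<le> sin (pi * t)"
proof -
  have "convex_on {0..pi} (\<lambda>x. - sin x)"
  proof (rule f''_ge0_imp_convex)
    show "((\<lambda>x. - sin x) has_real_derivative - cos x) (at x)" for x :: real
      by (auto intro!: derivative_eq_intros)
    show "((\<lambda>x. - cos x) has_real_derivative sin x) (at x)" for x :: real
      by (auto intro!: derivative_eq_intros)
  qed (auto intro: sin_ge_zero)
  from convex_onD[OF this, of "2 * t" 0 "pi/2"] assms show ?thesis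
    by (simp add: mult.commute)
qed

text \<open>Normalised for period 1: the sum of exp (2 pi i k t) over |k| at most N, in real
  form.\<close>

definition dirichlet_kernel :: "nat \<Rightarrow> real \<Rightarrow> real" where
  "dirichlet_kernel N t = 1 + 2 * (\<Sum>k=1..N. cos (2 * pi * real k * t))"

lemma continuous_on_dirichlet_kernel [continuous_intros]:
  fixes g :: "'a::t2_space \<Rightarrow> real"
  shows "continuous_on A g \<Longrightarrow> continuous_on A (\<lambda>t. dirichlet_kernel N (g t))"
  unfolding dirichlet_kernel_def by (intro continuous_intros)

lemma dirichlet_kernel_minus: "dirichlet_kernel N (- t) = dirichlet_kernel N t"
  by (simp add: dirichlet_kernel_def)

lemma dirichlet_kernel_periodic: "dirichlet_kernel N (t + 1) = dirichlet_kernel N t"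
proof -
  have "cos (2 * pi * real k * (t + 1)) = cos (2 * pi * real k * t)" for k
    using cos_int_2pin[of "int k"] sin_int_2pin[of "int k"] by (simp add: distrib_left cos_add)
  then show ?thesis by (simp add: dirichlet_kernel_def)
qed

text \<open>Telescoping: each further cosine contributes the difference of two successive
  odd-frequency sines. The product form avoids a division by zero at integers.\<close>

lemma dirichlet_kernel_times_sin:
  "dirichlet_kernel N t * sin (pi * t) = sin ((2 * real N + 1) * (pi * t))"
proof (induction N)
  case 0
  then show ?case by (simp add: dirichlet_kernel_def)
next
  case (Suc N)
  have "dirichlet_kernel (Suc N) t = dirichlet_kernel N t + 2 * cos (2 * real (Suc N) * (pi * t))"
    by (simp add: dirichlet_kernel_def algebra_simps)
  moreover have "2 * cos (2 * real (Suc N) * (pi * t)) * sin (pi * t)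
      = sin ((2 * real (Suc N) + 1) * (pi * t)) - sin ((2 * real N + 1) * (pi * t))"
  proof -
    have "(2 * real (Suc N) + 1) * (pi * t) = 2 * real (Suc N) * (pi * t) + pi * t"
      "(2 * real N + 1) * (pi * t) = 2 * real (Suc N) * (pi * t) - pi * t"
      by (simp_all add: algebra_simps)
    then show ?thesis by (simp only: sin_add sin_diff)
  qed
  ultimately show ?case
    using Suc.IH by (simp only: distrib_right)
qed

lemma abs_dirichlet_kernel_le: "\<bar>dirichlet_kernel N t\<bar> \<le> 2 * real N + 1"
proof -
  have "\<bar>\<Sum>k=1..N. cos (2 * pi * real k * t)\<bar> \<le> (\<Sum>k=1..N. 1)"
    by (intro order.trans[OF sum_abs] sum_mono) simp
  then show ?thesis unfolding dirichlet_kernel_def by simp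
qed

text \<open>Adds up two estimates: 2 N + 1, good near 0, and 1 / (2 t), good elsewhere. The combined
  bound has no pole at 0 and a logarithmic primitive, so the range of integration need not be
  split.\<close>

lemma abs_dirichlet_kernel_le_half:
  assumes "0 \<le> t" "t \<le> 1/2"
  shows "\<bar>dirichlet_kernel N t\<bar> \<le> 2 / (1 / (2 * real N + 1) + 2 * t)"
proof -
  define a where "a = \<bar>dirichlet_kernel N t\<bar>"
  have "a * (2 * t) \<le> a * sin (pi * t)"
    using sin_pi_ge[OF assms] by (intro mult_left_mono) (auto simp: a_def)
  also have "\<dots> = \<bar>dirichlet_kernel N t * sin (pi * t)\<bar>"
    using sin_pi_ge[OF assms] assms by (simp add: a_def abs_mult)
  also have "\<dots> \<le> 1" by (simp add: dirichlet_kernel_times_sin)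
  finally have 1: "a * (2 * t) \<le> 1" .
  have "a / (2 * real N + 1) \<le> 1"
    using abs_dirichlet_kernel_le[of N t] by (simp add: a_def)
  with 1 have "a * (1 / (2 * real N + 1) + 2 * t) \<le> 2"
    unfolding distrib_left times_divide_eq_right mult_1_right by linarith
  moreover have "0 < 1 / (2 * real N + 1) + 2 * t"
    using assms by (intro add_pos_nonneg) auto
  ultimately show ?thesis by (simp add: a_def pos_le_divide_eq)
qed

text \<open>Evenness and period 1 carry the half-period bound from \<open>t\<close> to
  \<open>1 - t\<close>. Taking the sum of both bounds gives a single majorant on the whole
  period.\<close>

lemma abs_dirichlet_kernel_le_unit:
  assumes "0 \<le> t" "t \<le> 1"
  shows "\<bar>dirichlet_kernel N t\<bar> \<le>
    2 / (1 / (2 * real N + 1) + 2 * t) + 2 / (1 / (2 * real N + 1) + 2 * (1 - t))"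
proof -
  have pos: "0 \<le> 2 / (1 / (2 * real N + 1) + 2 * s)" if "0 \<le> s" for s
    using that by simp
  have "dirichlet_kernel N (1 - t) = dirichlet_kernel N t"
    using dirichlet_kernel_minus[of N "t - 1"] dirichlet_kernel_periodic[of N "t - 1"] by simp
  moreover have "0 \<le> 1 - t" using assms by simp
  moreover have "t \<le> 1/2 \<or> 1 - t \<le> 1/2" by linarith
  ultimately show ?thesis
    using abs_dirichlet_kernel_le_half[of t N] abs_dirichlet_kernel_le_half[of "1 - t" N]
      pos[of t] pos[of "1 - t"] assms(1) by linarith
qed

text \<open>The logarithmic bound for the Lebesgue constant: with
  \<open>d = 1 / (2 * real N + 1)\<close>, each half of the majorant integrates to ln ((d + 2) /
  d).\<close>

lemma integral_abs_dirichlet_kernel_le: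
  "integral {0..1} (\<lambda>t. \<bar>dirichlet_kernel N t\<bar>) \<le> 2 * ln (4 * real N + 3)"
proof -
  define d where "d = 1 / (2 * real N + 1)"
  have d: "d > 0" "(d + 2) / d = 4 * real N + 3" by (simp_all add: d_def field_simps)
  have "((\<lambda>t. 2 / (d + 2 * t) + 2 / (d + 2 * (1 - t))) has_integral
      ((ln (d + 2 * 1) - ln (d + 2 * (1 - 1))) - (ln (d + 2 * 0) - ln (d + 2 * (1 - 0))))) {0..1}"
    using d(1) by (intro fundamental_theorem_of_calculus)
      (auto intro!: derivative_eq_intros simp flip: has_real_derivative_iff_has_vector_derivative
        simp: field_simps add_pos_nonneg)
  moreover have "ln (d + 2) - ln d = ln (4 * real N + 3)"
    using d(1) ln_div[of "d + 2" d] by (simp add: d(2))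
  ultimately have *: "((\<lambda>t. 2 / (d + 2 * t) + 2 / (d + 2 * (1 - t))) has_integral
      2 * ln (4 * real N + 3)) {0..1}" by (simp add: algebra_simps)
  have "(\<lambda>t. \<bar>dirichlet_kernel N t\<bar>) integrable_on {0..1}"
    by (intro integrable_continuous_interval continuous_intros)
  then show ?thesis
    using has_integral_le[OF integrable_integral *]
      abs_dirichlet_kernel_le_unit by (auto simp: d_def)
qed

text \<open>The integral over [c, c + 1] has derivative h (c + 1) - h c = 0 in c.\<close>

lemma integral_unit_interval_shift:
  fixes h :: "real \<Rightarrow> real"
  assumes cont: "continuous_on UNIV h" and per: "\<And>t. h (t + 1) = h t"
  shows "integral {a..a+1} h = integral {b..b+1} h"
proof -
  have "isCont h x" for x using cont by (simp add: continuous_on_eq_continuous_at)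
  \<comment> \<open>One antiderivative on the whole line, so that the base point can vary
    freely.\<close>
  from einterval_antiderivative[of "-\<infinity>" "\<infinity>" h, OF _ this]
  obtain H where H: "\<And>x. (H has_vector_derivative h x) (at x)" by auto
  have int: "integral {c..c+1} h = H (c + 1) - H c" for c
    by (intro integral_unique fundamental_theorem_of_calculus)
      (auto intro: has_vector_derivative_at_within[OF H])
  have "((\<lambda>c. H (c + 1) - H c) has_real_derivative 0) (at x)" for x
  proof -
    have D: "(H has_real_derivative h x) (at x)" for x
      using H by (simp add: has_real_derivative_iff_has_vector_derivative)
    have "((\<lambda>c. H (c + 1)) has_real_derivative h (x + 1)) (at x)"
      using D[of "x + 1"] by (simp add: DERIV_shift)
    from DERIV_diff[OF this D] show ?thesis by (simp add: per)
  qed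
  then have "H (a + 1) - H a = H (b + 1) - H b" using DERIV_isconst_all by blast
  with int show ?thesis by simp
qed

subsection \<open>Fourier remainder of the sawtooth\<close>

text \<open>On (0, 1) the Fourier series of 1/2 - t is the sum of sin (2 pi k t) / (pi k); this is
  its tail. The linear function is not periodized, so the jump of the sawtooth appears as different
  values at 0 and 1.\<close>

definition sawtooth_remainder :: "nat \<Rightarrow> real \<Rightarrow> real" where
  "sawtooth_remainder N t = 1/2 - t - (\<Sum>k=1..N. sin (2 * pi * real k * t) / (pi * real k))"

lemma continuous_on_sawtooth_remainder [continuous_intros]:
  fixes g :: "'a::t2_space \<Rightarrow> real"
  shows "continuous_on A g \<Longrightarrow> continuous_on A (\<lambda>t. sawtooth_remainder N (g t))"
  unfolding sawtooth_remainder_def divide_inverse by (intro continuous_intros)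

lemma sawtooth_remainder_ends: "sawtooth_remainder N 0 = 1/2" "sawtooth_remainder N 1 = - 1/2"
proof -
  have "sin (2 * pi * real k) = 0" for k
    using sin_int_2pin[of "int k"] by simp
  then show "sawtooth_remainder N 0 = 1/2" "sawtooth_remainder N 1 = - 1/2"
    by (simp_all add: sawtooth_remainder_def)
qed

lemma has_real_derivative_sawtooth_remainder:
  "(sawtooth_remainder N has_real_derivative - dirichlet_kernel N t) (at t within S)"
proof -
  have "((\<lambda>t. sin (2 * pi * real k * t) / (pi * real k)) has_real_derivative
      2 * cos (2 * pi * real k * t)) (at t within S)" if "k \<in> {1..N}" for k
    using that by (auto intro!: derivative_eq_intros)
  then have "((\<lambda>t. \<Sum>k=1..N. sin (2 * pi * real k * t) / (pi * real k)) has_real_derivative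
      (\<Sum>k=1..N. 2 * cos (2 * pi * real k * t))) (at t within S)"
    by (rule DERIV_sum)
  then show ?thesis
    unfolding sawtooth_remainder_def[abs_def] dirichlet_kernel_def
    by (auto intro!: derivative_eq_intros simp: sum_distrib_left mult.commute)
qed

lemma has_integral_linear_times_sin:
  assumes "k \<ge> 1"
  shows "((\<lambda>t. (1/2 - t) * sin (2 * pi * real k * t)) has_integral 1 / (2 * pi * real k)) {0..1}"
proof -
  define c where "c = 2 * pi * real k"
  have c: "c > 0" "cos c = 1" "sin c = 0"
    using assms cos_int_2pin[of "int k"] sin_int_2pin[of "int k"] by (simp_all add: c_def)
  define F where "F t = - (1/2 - t) * cos (c * t) / c - sin (c * t) / c\<^sup>2" for t
  have "((\<lambda>t. (1/2 - t) * sin (c * t)) has_integral (F 1 - F 0)) {0..1}"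
    unfolding F_def using c(1)
    by (intro fundamental_theorem_of_calculus)
      (auto intro!: derivative_eq_intros simp flip: has_real_derivative_iff_has_vector_derivative
        simp: field_simps power2_eq_square)
  moreover have "F 1 - F 0 = 1 / c" using c by (simp add: F_def field_simps)
  ultimately show ?thesis by (simp add: c_def)
qed

lemma has_integral_sin_times_sin:
  assumes "j \<ge> 1" "k \<ge> 1"
  shows "((\<lambda>t. sin (2 * pi * real j * t) * sin (2 * pi * real k * t)) has_integral
    (if j = k then 1/2 else 0)) {0..1}"
proof -
  have 0: "sin (2 * pi * (real j - real k)) = 0" "sin (2 * pi * (real j + real k)) = 0"
    using sin_int_2pin[of "int j - int k"] sin_int_2pin[of "int j + int k"] by simp_all
  \<comment> \<open>A primitive after product-to-sum. For \<open>j = k\<close> the difference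
    frequency vanishes, its cosine is constantly 1, and the primitive is \<open>t\<close>.\<close>
  define F where "F t = ((if j = k then t else
      sin (2 * pi * (real j - real k) * t) / (2 * pi * (real j - real k)))
    - sin (2 * pi * (real j + real k) * t) / (2 * pi * (real j + real k))) / 2" for t
  have D: "(F has_real_derivative (cos (2 * pi * (real j - real k) * t)
      - cos (2 * pi * (real j + real k) * t)) / 2) (at t within {0..1})" for t
    using assms unfolding F_def
    by (cases "j = k") (auto intro!: derivative_eq_intros)
  have "((\<lambda>t. (cos (2 * pi * (real j - real k) * t) - cos (2 * pi * (real j + real k) * t)) / 2)
      has_integral (F 1 - F 0)) {0..1}"
    using D by (intro fundamental_theorem_of_calculus)
      (auto simp flip: has_real_derivative_iff_has_vector_derivative)
  moreover have "F 1 - F 0 = (if j = k then 1/2 else 0)"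
    using 0 by (simp add: F_def)
  moreover have "(cos (2 * pi * (real j - real k) * t) - cos (2 * pi * (real j + real k) * t)) / 2
      = sin (2 * pi * real j * t) * sin (2 * pi * real k * t)" for t
    by (simp add: sin_times_sin algebra_simps)
  ultimately show ?thesis by simp
qed

text \<open>Frequencies above \<open>N\<close> are orthogonal to the subtracted partial sum, so only
  the coefficient of 1/2 - t is left.\<close>

lemma has_integral_sawtooth_remainder_times_sin:
  assumes "m > N"
  shows "((\<lambda>t. sawtooth_remainder N t * sin (2 * pi * real m * t)) has_integral
    1 / (2 * pi * real m)) {0..1}"
proof -
  have "((\<lambda>t. (\<Sum>k=1..N. (sin (2 * pi * real k * t) * sin (2 * pi * real m * t)) * (1 / (pi * real k))))
      has_integral (\<Sum>k=1..N. 0 * (1 / (pi * real k)))) {0..1}"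
  proof (intro has_integral_sum has_integral_mult_left)
    fix k assume "k \<in> {1..N}"
    then show "((\<lambda>t. sin (2 * pi * real k * t) * sin (2 * pi * real m * t)) has_integral 0) {0..1}"
      using assms has_integral_sin_times_sin[of k m] by simp
  qed simp
  from has_integral_diff[OF has_integral_linear_times_sin[of m] this] assms
  show ?thesis
    by (simp add: sawtooth_remainder_def left_diff_distrib sum_distrib_right)
qed

text \<open>Bessel's identity by induction: the integral of (1/2 - t)^2 is 1/12, and removing the
  frequency m lowers the squared norm by 1 / (2 pi^2 m^2).\<close>

lemma has_integral_sawtooth_remainder_squared:
  "((\<lambda>t. (sawtooth_remainder N t)\<^sup>2) has_integral
    1/12 - (\<Sum>k=1..N. 1 / (real k)\<^sup>2) / (2 * pi\<^sup>2)) {0..1}"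
proof (induction N)
  case 0
  have "((\<lambda>t. (1/2 - t)\<^sup>2) has_integral (- ((1/2 - 1)^3 / 3) - (- ((1/2 - 0)^3 / 3)))) {0..1::real}"
    by (intro fundamental_theorem_of_calculus)
      (auto intro!: derivative_eq_intros simp flip: has_real_derivative_iff_has_vector_derivative)
  then show ?case by (simp add: sawtooth_remainder_def power3_eq_cube)
next
  case (Suc N)
  define m where "m = Suc N"
  have m: "m > N" "m \<ge> 1" by (simp_all add: m_def)
  have "((\<lambda>t. (sawtooth_remainder N t)\<^sup>2
       - 2 / (pi * real m) * (sawtooth_remainder N t * sin (2 * pi * real m * t))
       + (1 / (pi * real m))\<^sup>2 * (sin (2 * pi * real m * t) * sin (2 * pi * real m * t)))
     has_integral ((1/12 - (\<Sum>k=1..N. 1 / (real k)\<^sup>2) / (2 * pi\<^sup>2))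
       - 2 / (pi * real m) * (1 / (2 * pi * real m)) + (1 / (pi * real m))\<^sup>2 * (1/2))) {0..1}"
    using has_integral_sin_times_sin[OF m(2) m(2)]
    by (intro has_integral_add has_integral_diff has_integral_mult_right Suc.IH
        has_integral_sawtooth_remainder_times_sin m) simp
  moreover have "(sawtooth_remainder N t)\<^sup>2
       - 2 / (pi * real m) * (sawtooth_remainder N t * sin (2 * pi * real m * t))
       + (1 / (pi * real m))\<^sup>2 * (sin (2 * pi * real m * t) * sin (2 * pi * real m * t))
     = (sawtooth_remainder m t)\<^sup>2" for t
  proof -
    have *: "sawtooth_remainder m t =
        sawtooth_remainder N t - 1 / (pi * real m) * sin (2 * pi * real m * t)"
      by (simp add: sawtooth_remainder_def m_def)
    show ?thesis unfolding * by (simp add: power2_eq_square algebra_simps)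
  qed
  moreover have "(1/12 - (\<Sum>k=1..N. 1 / (real k)\<^sup>2) / (2 * pi\<^sup>2))
       - 2 / (pi * real m) * (1 / (2 * pi * real m)) + (1 / (pi * real m))\<^sup>2 * (1/2)
     = 1/12 - (\<Sum>k=1..m. 1 / (real k)\<^sup>2) / (2 * pi\<^sup>2)"
    by (simp add: m_def power2_eq_square add_divide_distrib)
  ultimately show ?case by (simp only: m_def)
qed

text \<open>Since 1 / (K + 1)^2 is at most 1 / K - 1 / (K + 1), the partial sum plus 1 / K decreases
  in K; its limit is the Basel value.\<close>

lemma inverse_squares_tail_le:
  assumes "N \<ge> 1"
  shows "pi\<^sup>2 / 6 \<le> (\<Sum>k=1..N. 1 / (real k)\<^sup>2) + 1 / real N"
proof -
  have step: "(\<Sum>k=1..K. 1 / (real k)\<^sup>2) + 1 / real K \<le> (\<Sum>k=1..N. 1 / (real k)\<^sup>2) + 1 / real N"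
    if "K \<ge> N" for K
    using that
  proof (induction K rule: dec_induct)
    case (step K)
    have "1 / (real (Suc K))\<^sup>2 + 1 / real (Suc K) \<le> 1 / real K"
    proof -
      have K: "real K > 0" using step.hyps assms by simp
      have "1 / (real (Suc K))\<^sup>2 \<le> 1 / (real K * real (Suc K))"
        using K by (intro divide_left_mono) (auto simp: power2_eq_square intro!: mult_right_mono)
      also have "\<dots> = 1 / real K - 1 / real (Suc K)" using K by (simp add: field_simps)
      finally show ?thesis by simp
    qed
    with step show ?case by simp
  qed simp
  have "(\<lambda>K. \<Sum>n<K. 1 / (real n + 1)\<^sup>2) \<longlonglongrightarrow> pi\<^sup>2 / 6"
    using inverse_squares_sums unfolding sums_def by (simp add: add.commute)
  moreover have "(\<Sum>n<K. 1 / (real n + 1)\<^sup>2) = (\<Sum>k=1..K. 1 / (real k)\<^sup>2)" for K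
    by (rule sum.reindex_bij_witness[of _ "\<lambda>k. k - 1" Suc]) auto
  ultimately have "(\<lambda>K. \<Sum>k=1..K. 1 / (real k)\<^sup>2) \<longlonglongrightarrow> pi\<^sup>2 / 6" by simp
  then show ?thesis
  proof (rule LIMSEQ_le_const2)
    show "\<exists>K. \<forall>L\<ge>K. (\<Sum>k=1..L. 1 / (real k)\<^sup>2) \<le> (\<Sum>k=1..N. 1 / (real k)\<^sup>2) + 1 / real N"
    proof (intro exI[of _ N] allI impI)
      fix L assume "L \<ge> N"
      then show "(\<Sum>k=1..L. 1 / (real k)\<^sup>2) \<le> (\<Sum>k=1..N. 1 / (real k)\<^sup>2) + 1 / real N"
        using step[of L] by (smt (verit) of_nat_0_le_iff zero_le_divide_1_iff)
    qed
  qed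
qed

text \<open>As 1/12 = (pi^2 / 6) / (2 pi^2), the squared norm is a tail of the Basel series, hence
  at most 1 / N. A pointwise arithmetic-geometric mean bound takes the place of Cauchy-Schwarz in
  passing to the L1 norm.\<close>

lemma integral_abs_sawtooth_remainder_le:
  assumes "N \<ge> 1"
  shows "integral {0..1} (\<lambda>t. \<bar>sawtooth_remainder N t\<bar>) \<le> 1 / sqrt (real N)"
proof -
  \<comment> \<open>This weight balances the pointwise bound: after integration each of its two
    terms is at most 1 / (2 r).\<close>
  define r where "r = sqrt (real N)"
  have r: "r > 0" "r\<^sup>2 = real N" using assms by (simp_all add: r_def)
  have "1/12 - (\<Sum>k=1..N. 1 / (real k)\<^sup>2) / (2 * pi\<^sup>2) \<le> (1 / real N) / (2 * pi\<^sup>2)"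
    using inverse_squares_tail_le[OF assms] by (simp add: field_simps)
  also have "\<dots> \<le> (1 / real N) / 1"
  proof (rule divide_left_mono)
    have "1 \<le> pi\<^sup>2" using pi_gt3 by (intro one_le_power) simp
    then show "1 \<le> 2 * pi\<^sup>2" by simp
  qed auto
  finally have sq: "1/12 - (\<Sum>k=1..N. 1 / (real k)\<^sup>2) / (2 * pi\<^sup>2) \<le> 1 / r\<^sup>2" using r by simp
  have "integral {0..1} (\<lambda>t. \<bar>sawtooth_remainder N t\<bar>)
      \<le> r / 2 * (1/12 - (\<Sum>k=1..N. 1 / (real k)\<^sup>2) / (2 * pi\<^sup>2)) + 1 / (2 * r)"
  proof (rule has_integral_le[OF integrable_integral])
    show "(\<lambda>t. \<bar>sawtooth_remainder N t\<bar>) integrable_on {0..1}"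
      by (intro integrable_continuous_interval continuous_intros)
    show "((\<lambda>t. r / 2 * (sawtooth_remainder N t)\<^sup>2 + 1 / (2 * r)) has_integral
      r / 2 * (1/12 - (\<Sum>k=1..N. 1 / (real k)\<^sup>2) / (2 * pi\<^sup>2)) + 1 / (2 * r)) {0..1}"
      using has_integral_const_real[of "1 / (2 * r)" 0 1]
      by (intro has_integral_add has_integral_mult_right has_integral_sawtooth_remainder_squared) simp
    show "\<bar>sawtooth_remainder N t\<bar> \<le> r / 2 * (sawtooth_remainder N t)\<^sup>2 + 1 / (2 * r)" for t
    proof -
      have "0 \<le> (r * \<bar>sawtooth_remainder N t\<bar> - 1)\<^sup>2" by simp
      then have "2 * r * \<bar>sawtooth_remainder N t\<bar> \<le> r\<^sup>2 * (sawtooth_remainder N t)\<^sup>2 + 1"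
        by (simp add: power2_diff power_mult_distrib mult_ac)
      then show ?thesis using r(1) by (simp add: field_simps power2_eq_square)
    qed
  qed
  also have "\<dots> \<le> r / 2 * (1 / r\<^sup>2) + 1 / (2 * r)"
    using sq r by (intro add_right_mono mult_left_mono) auto
  also have "\<dots> = 1 / r" using r(1) by (simp add: power2_eq_square field_simps)
  finally show ?thesis by (simp add: r_def)
qed

subsection \<open>Sine series on a half period\<close>

text \<open>Integration by parts: the sawtooth remainder is a primitive of minus the Dirichlet
  kernel, and its boundary values 1/2 and -1/2 produce exactly \<open>g s\<close>. The error is the
  integral of the remainder against \<open>g'\<close>, at most \<open>M\<close> times its L1
  norm.\<close>

lemma dirichlet_integral_error:
  assumes deriv: "\<And>t. (g has_real_derivative g' t) (at t)"
    and cont: "continuous_on UNIV g'" and bound: "\<And>t. \<bar>g' t\<bar> \<le> M"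
    and per: "\<And>t. g (t + 1) = g t" and "N \<ge> 1"
  shows "\<bar>integral {0..1} (\<lambda>t. dirichlet_kernel N t * g (s + t)) - g s\<bar> \<le> M / sqrt (real N)"
proof -
  have contg: "continuous_on UNIV g"
    using deriv by (intro DERIV_continuous_on[of _ _ g']) (auto intro: has_field_derivative_at_within)
  have [continuous_intros]: "continuous_on A (\<lambda>t. g (s + t))" "continuous_on A (\<lambda>t. g' (s + t))" for A
    by (auto intro!: continuous_on_compose2[OF contg] continuous_on_compose2[OF cont] continuous_intros)
  have "((\<lambda>t. sawtooth_remainder N t * g (s + t)) has_real_derivative
      - dirichlet_kernel N t * g (s + t) + sawtooth_remainder N t * g' (s + t)) (at t within {0..1})" for t
  proof -
    have "((\<lambda>t. g (s + t)) has_real_derivative g' (s + t)) (at t)"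
      by (rule DERIV_cong[OF DERIV_chain2[OF deriv]]) (auto intro!: derivative_eq_intros)
    then have "((\<lambda>t. g (s + t)) has_real_derivative g' (s + t)) (at t within {0..1})"
      by (rule has_field_derivative_at_within)
    from DERIV_mult[OF has_real_derivative_sawtooth_remainder this] show ?thesis
      by (simp add: mult.commute)
  qed
  then have "((\<lambda>t. - dirichlet_kernel N t * g (s + t) + sawtooth_remainder N t * g' (s + t)) has_integral
      (sawtooth_remainder N 1 * g (s + 1) - sawtooth_remainder N 0 * g (s + 0))) {0..1}"
    by (intro fundamental_theorem_of_calculus)
      (auto simp flip: has_real_derivative_iff_has_vector_derivative)
  moreover have "((\<lambda>t. dirichlet_kernel N t * g (s + t)) has_integral
      integral {0..1} (\<lambda>t. dirichlet_kernel N t * g (s + t))) {0..1}"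
    by (intro integrable_integral integrable_continuous_interval continuous_intros)
  ultimately have "((\<lambda>t. (- dirichlet_kernel N t * g (s + t) + sawtooth_remainder N t * g' (s + t))
      + dirichlet_kernel N t * g (s + t)) has_integral
    (sawtooth_remainder N 1 * g (s + 1) - sawtooth_remainder N 0 * g (s + 0))
      + integral {0..1} (\<lambda>t. dirichlet_kernel N t * g (s + t))) {0..1}"
    by (rule has_integral_add)
  then have "((\<lambda>t. sawtooth_remainder N t * g' (s + t)) has_integral
      (integral {0..1} (\<lambda>t. dirichlet_kernel N t * g (s + t)) - g s)) {0..1}"
    by (simp add: sawtooth_remainder_ends per)
  then have eq: "integral {0..1} (\<lambda>t. dirichlet_kernel N t * g (s + t)) - g s
      = integral {0..1} (\<lambda>t. sawtooth_remainder N t * g' (s + t))"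
    by (simp add: integral_unique)
  have "M \<ge> 0" using bound[of 0] by linarith
  have "\<bar>integral {0..1} (\<lambda>t. sawtooth_remainder N t * g' (s + t))\<bar>
      \<le> integral {0..1} (\<lambda>t. \<bar>sawtooth_remainder N t\<bar> * M)"
    unfolding real_norm_def[symmetric]
    by (rule integral_norm_bound_integral)
      (auto intro!: integrable_continuous_interval continuous_intros mult_left_mono bound simp: abs_mult)
  also have "\<dots> = M * integral {0..1} (\<lambda>t. \<bar>sawtooth_remainder N t\<bar>)" by (simp add: mult.commute)
  also have "\<dots> \<le> M * (1 / sqrt (real N))"
    by (intro mult_left_mono integral_abs_sawtooth_remainder_le assms \<open>M \<ge> 0\<close>)
  finally show ?thesis unfolding eq by simp
qed

text \<open>Substitute u = s + t, move the period to [-1/2, 1/2], and reflect its negative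
  half.\<close>

lemma integral_dirichlet_kernel_fold:
  assumes cont: "continuous_on UNIV (g :: real \<Rightarrow> real)" and per: "\<And>t. g (t + 1) = g t"
  shows "integral {0..1} (\<lambda>t. dirichlet_kernel N t * g (s + t))
    = integral {0..1/2} (\<lambda>u. dirichlet_kernel N (u - s) * g u + dirichlet_kernel N (u + s) * g (- u))"
proof -
  have [continuous_intros]: "continuous_on A (\<lambda>t. g (h t))" if "continuous_on A h"
    for A and h :: "real \<Rightarrow> real"
    by (rule continuous_on_compose2[OF cont that]) auto
  define h where "h u = dirichlet_kernel N (u - s) * g u" for u
  have h[continuous_intros]: "continuous_on A h" for A
    unfolding h_def by (intro continuous_intros)
  have hper: "h (u + 1) = h u" for u
    using dirichlet_kernel_periodic[of N "u - s"] per[of u] by (simp add: h_def algebra_simps)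
  have "integral {0..1} (\<lambda>t. dirichlet_kernel N t * g (s + t)) = integral {s..s+1} h"
    using integral_shift_real_ivl[of s s "s + 1" h] by (simp add: h_def add.commute)
  also have "\<dots> = integral {-1/2..1/2} h"
    using integral_unit_interval_shift[of h s "-1/2"] h hper by simp
  also have "\<dots> = integral {-1/2..0} h + integral {0..1/2} h"
    by (rule Henstock_Kurzweil_Integration.integral_combine[symmetric])
      (auto intro!: integrable_continuous_interval continuous_intros)
  also have "integral {-1/2..0} h = integral {0..1/2} (\<lambda>u. h (- u))"
    using Henstock_Kurzweil_Integration.integral_reflect_real[of "1/2" 0 "\<lambda>u. h (- u)"] by simp
  also have "(\<lambda>u. h (- u)) = (\<lambda>u. dirichlet_kernel N (u + s) * g (- u))"
    using dirichlet_kernel_minus[of N "u + s" for u] by (auto simp: h_def fun_eq_iff)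
  also have "integral {0..1/2} (\<lambda>u. dirichlet_kernel N (u + s) * g (- u)) + integral {0..1/2} h
    = integral {0..1/2} (\<lambda>u. dirichlet_kernel N (u + s) * g (- u) + h u)"
    by (intro integral_add[symmetric] integrable_continuous_interval continuous_intros)
  finally show ?thesis by (simp add: h_def add.commute)
qed

text \<open>Restricting the integration to a half period and folding in the odd part turns the Dirichlet
  kernel into this kernel, with the cut-off to \<open>[0, 1/2]\<close> built in.\<close>

definition sine_kernel :: "nat \<Rightarrow> real \<Rightarrow> real \<Rightarrow> real" where
  "sine_kernel N s t = indicator {0..1/2} t *
     (\<Sum>k=1..N. 4 * (sin (2 * pi * real k * s) * sin (2 * pi * real k * t)))"

text \<open>Product-to-sum; the constant terms of the two Dirichlet kernels cancel.\<close>

lemma sine_kernel_eq_dirichlet_kernel: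
  "sine_kernel N s t =
    indicator {0..1/2} t * (dirichlet_kernel N (t - s) - dirichlet_kernel N (t + s))"
proof -
  have "4 * (sin (2 * pi * real k * s) * sin (2 * pi * real k * t))
      = 2 * cos (2 * pi * real k * (t - s)) - 2 * cos (2 * pi * real k * (t + s))" for k
    using sin_times_sin[of "2 * pi * real k * t" "2 * pi * real k * s"] by (simp add: algebra_simps)
  then show ?thesis
    by (simp add: sine_kernel_def dirichlet_kernel_def sum_distrib_left sum_subtractf right_diff_distrib)
qed

text \<open>Bridge from the gauge integral of the one-dimensional estimates to the Lebesgue
  integral, for which Fubini is applied later.\<close>

lemma lborel_integral_sine_kernel:
  assumes "continuous_on UNIV (g :: real \<Rightarrow> real)"
  shows "(\<integral>t. sine_kernel N s t * g t \<partial>lborel) =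
      integral {0..1/2} (\<lambda>t. (dirichlet_kernel N (t - s) - dirichlet_kernel N (t + s)) * g t)"
    "integrable lborel (\<lambda>t. sine_kernel N s t * g t)"
proof -
  have "continuous_on {0..1/2} g" using assms continuous_on_subset by blast
  then have "set_integrable lborel {0..1/2}
      (\<lambda>t. (dirichlet_kernel N (t - s) - dirichlet_kernel N (t + s)) * g t)"
    by (intro borel_integrable_atLeastAtMost' continuous_intros)
  from set_borel_integral_eq_integral(2)[OF this] this
  show "(\<integral>t. sine_kernel N s t * g t \<partial>lborel) =
      integral {0..1/2} (\<lambda>t. (dirichlet_kernel N (t - s) - dirichlet_kernel N (t + s)) * g t)"
    "integrable lborel (\<lambda>t. sine_kernel N s t * g t)"
    unfolding set_integrable_def set_lebesgue_integral_def sine_kernel_eq_dirichlet_kernel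
    by (simp_all add: mult.assoc)
qed

lemma sine_kernel_error:
  assumes deriv: "\<And>t. (g has_real_derivative g' t) (at t)"
    and cont: "continuous_on UNIV g'" and bound: "\<And>t. \<bar>g' t\<bar> \<le> M"
    and per: "\<And>t. g (t + 1) = g t" and odd: "\<And>t. g (- t) = - g t" and "N \<ge> 1"
  shows "\<bar>(\<integral>t. sine_kernel N s t * g t \<partial>lborel) - g s\<bar> \<le> M / sqrt (real N)"
proof -
  have contg: "continuous_on UNIV g"
    using deriv by (intro DERIV_continuous_on[of _ _ g']) (auto intro: has_field_derivative_at_within)
  show ?thesis
    using dirichlet_integral_error[OF deriv cont bound per \<open>N \<ge> 1\<close>, of s]
    unfolding integral_dirichlet_kernel_fold[OF contg per] lborel_integral_sine_kernel(1)[OF contg]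
    by (simp add: odd left_diff_distrib)
qed

lemma sine_kernel_integrable: "integrable lborel (sine_kernel N s)"
  using lborel_integral_sine_kernel(2)[of "\<lambda>_. 1" N s] by simp

text \<open>The folding is undone: the two shifted Dirichlet kernels on a half period become one
  kernel on a full period, and periodicity removes the shift. The bound is therefore uniform in
  \<open>s\<close>.\<close>

lemma integral_abs_sine_kernel_le: "(\<integral>t. \<bar>sine_kernel N s t\<bar> \<partial>lborel) \<le> 2 * ln (4 * real N + 3)"
proof -
  have "(\<integral>t. \<bar>sine_kernel N s t\<bar> \<partial>lborel) =
      (LINT t:{0..1/2}|lborel. \<bar>dirichlet_kernel N (t - s) - dirichlet_kernel N (t + s)\<bar>)"
    by (simp add: sine_kernel_eq_dirichlet_kernel set_lebesgue_integral_def abs_mult)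
  also have "\<dots> = integral {0..1/2} (\<lambda>t. \<bar>dirichlet_kernel N (t - s) - dirichlet_kernel N (t + s)\<bar>)"
    by (intro set_borel_integral_eq_integral borel_integrable_atLeastAtMost' continuous_intros)
  also have "\<dots> \<le> integral {0..1/2} (\<lambda>u. \<bar>dirichlet_kernel N (u - s)\<bar> + \<bar>dirichlet_kernel N (u + s)\<bar>)"
    by (intro integral_le integrable_continuous_interval continuous_intros) linarith
  also have "\<dots> = integral {-1/2..1/2} (\<lambda>u. \<bar>dirichlet_kernel N (u - s)\<bar>)"
  proof -
    define h where "h u = \<bar>dirichlet_kernel N (u - s)\<bar>" for u
    have h[continuous_intros]: "continuous_on A h" for A
      unfolding h_def by (intro continuous_intros)
    have "integral {-1/2..1/2} h = integral {-1/2..0} h + integral {0..1/2} h"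
      by (rule Henstock_Kurzweil_Integration.integral_combine[symmetric])
        (auto intro!: integrable_continuous_interval continuous_intros)
    also have "integral {-1/2..0} h = integral {0..1/2} (\<lambda>u. h (- u))"
      using Henstock_Kurzweil_Integration.integral_reflect_real[of "1/2" 0 "\<lambda>u. h (- u)"] by simp
    also have "(\<lambda>u. h (- u)) = (\<lambda>u. \<bar>dirichlet_kernel N (u + s)\<bar>)"
      using dirichlet_kernel_minus[of N "u + s" for u] by (auto simp: h_def fun_eq_iff)
    also have "integral {0..1/2} (\<lambda>u. \<bar>dirichlet_kernel N (u + s)\<bar>) + integral {0..1/2} h
      = integral {0..1/2} (\<lambda>u. \<bar>dirichlet_kernel N (u + s)\<bar> + h u)"
      by (intro integral_add[symmetric] integrable_continuous_interval continuous_intros)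
    finally show ?thesis by (simp add: h_def add.commute)
  qed
  also have "\<dots> = integral {-1/2-s..1/2-s} (\<lambda>t. \<bar>dirichlet_kernel N t\<bar>)"
    using integral_shift_real_ivl[of "-1/2" s "1/2" "\<lambda>u. \<bar>dirichlet_kernel N (u - s)\<bar>"] by simp
  also have "\<dots> = integral {0..1} (\<lambda>t. \<bar>dirichlet_kernel N t\<bar>)"
  proof -
    have "continuous_on UNIV (\<lambda>t. \<bar>dirichlet_kernel N t\<bar>)" by (intro continuous_intros)
    from integral_unit_interval_shift[OF this, of "-1/2-s" 0] show ?thesis
      by (simp add: dirichlet_kernel_periodic)
  qed
  also have "\<dots> \<le> 2 * ln (4 * real N + 3)" by (rule integral_abs_dirichlet_kernel_le)
  finally show ?thesis .
qed

subsection \<open>Products of sine kernels\<close>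

interpretation lborel_product: product_sigma_finite "\<lambda>_. lborel :: real measure"
  by (rule product_sigma_finite.intro) (rule sigma_finite_lborel)

text \<open>The sine partial sum taken in the coordinates in \<open>J\<close> only, the others
  staying at \<open>x\<close>; varying \<open>J\<close> permits induction over the coordinates.
  Points are functions on the index type because Fubini for \<open>Pi\<^sub>M\<close> is stated for
  these.\<close>

definition product_kernel_integral ::
    "nat \<Rightarrow> 'i set \<Rightarrow> (('i \<Rightarrow> real) \<Rightarrow> real) \<Rightarrow> ('i \<Rightarrow> real) \<Rightarrow> real" where
  "product_kernel_integral N J F x =
     (\<integral>t. (\<Prod>j\<in>J. sine_kernel N (x j) (t j)) * F (override_on x t J) \<partial>(Pi\<^sub>M J (\<lambda>_. lborel)))"

lemma measurable_override_on:
  "(\<lambda>t. override_on x t J) \<in> Pi\<^sub>M J (\<lambda>_. lborel) \<rightarrow>\<^sub>M Pi\<^sub>M UNIV (\<lambda>_. lborel :: real measure)"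
proof (rule measurable_PiM_single')
  show "(\<lambda>t. override_on x t J i) \<in> Pi\<^sub>M J (\<lambda>_. lborel) \<rightarrow>\<^sub>M lborel" for i
    by (cases "i \<in> J") (auto simp: override_on_def)
qed auto

lemma measurable_sine_kernel [measurable]: "sine_kernel N s \<in> borel_measurable borel"
  using sine_kernel_integrable[of N s] by auto

lemma product_kernel_integrable:
  assumes "finite J"
  shows "integrable (Pi\<^sub>M J (\<lambda>_. lborel)) (\<lambda>t. \<Prod>j\<in>J. sine_kernel N (x j) (t j))"
    "integrable (Pi\<^sub>M J (\<lambda>_. lborel)) (\<lambda>t. \<Prod>j\<in>J. \<bar>sine_kernel N (x j) (t j)\<bar>)"
  using assms
  by (auto intro!: lborel_product.product_integrable_prod sine_kernel_integrable integrable_abs)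

lemma integral_abs_product_kernel_le:
  assumes "finite J"
  shows "(\<integral>t. (\<Prod>j\<in>J. \<bar>sine_kernel N (x j) (t j)\<bar>) \<partial>(Pi\<^sub>M J (\<lambda>_. lborel)))
    \<le> (2 * ln (4 * real N + 3)) ^ card J"
proof -
  have "(\<integral>t. (\<Prod>j\<in>J. \<bar>sine_kernel N (x j) (t j)\<bar>) \<partial>(Pi\<^sub>M J (\<lambda>_. lborel)))
      = (\<Prod>j\<in>J. \<integral>t. \<bar>sine_kernel N (x j) t\<bar> \<partial>lborel)"
    using assms
    by (intro lborel_product.product_integral_prod integrable_abs sine_kernel_integrable)
  also have "\<dots> \<le> (\<Prod>j\<in>J. 2 * ln (4 * real N + 3))"
    by (intro prod_mono conjI integral_abs_sine_kernel_le integral_nonneg) auto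
  finally show ?thesis by simp
qed

lemma product_kernel_times_bounded_integrable:
  assumes "finite J" and [measurable]: "h \<in> borel_measurable (Pi\<^sub>M J (\<lambda>_. lborel))"
    and bound: "\<And>t. \<bar>h t\<bar> \<le> B"
  shows "integrable (Pi\<^sub>M J (\<lambda>_. lborel)) (\<lambda>t. (\<Prod>j\<in>J. sine_kernel N (x j) (t j)) * h t)"
proof (rule Bochner_Integration.integrable_bound)
  show "integrable (Pi\<^sub>M J (\<lambda>_. lborel)) (\<lambda>t. (\<Prod>j\<in>J. sine_kernel N (x j) (t j)) * B)"
    by (intro integrable_mult_left product_kernel_integrable assms)
  show "AE t in Pi\<^sub>M J (\<lambda>_. lborel). norm ((\<Prod>j\<in>J. sine_kernel N (x j) (t j)) * h t)
      \<le> norm ((\<Prod>j\<in>J. sine_kernel N (x j) (t j)) * B)"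
    using bound by (auto simp: abs_mult intro!: mult_left_mono AE_I2 order.trans[OF bound])
qed (use borel_measurable_integrable[OF product_kernel_integrable(1)[OF assms(1)]] in measurable)

text \<open>Induction over the coordinates. Treating a new one costs at most \<open>e\<close> at
  every point, and integrating this error against the kernels already present multiplies it by at
  most the \<open>card J\<close>-th power of the Lebesgue constant bound; the costs add up to a
  geometric sum.\<close>

lemma product_kernel_integral_error:
  fixes F :: "('i \<Rightarrow> real) \<Rightarrow> real"
  assumes "finite J"
    and F[measurable]: "F \<in> borel_measurable (Pi\<^sub>M UNIV (\<lambda>_. lborel))"
    and bound: "\<And>v. \<bar>F v\<bar> \<le> B"
    and slice: "\<And>v i. \<bar>(\<integral>y. sine_kernel N (v i) y * F (v(i := y)) \<partial>lborel) - F v\<bar> \<le> e"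
  shows "\<bar>product_kernel_integral N J F x - F x\<bar> \<le> e * (\<Sum>k<card J. (2 * ln (4 * real N + 3)) ^ k)"
  using assms(1)
proof (induction J)
  case empty
  have "emeasure (Pi\<^sub>M {} (\<lambda>_. lborel :: real measure)) {\<lambda>_::'i. undefined} = 1" by simp
  then have "measure (Pi\<^sub>M {} (\<lambda>_. lborel :: real measure)) {\<lambda>_::'i. undefined} = 1"
    by (simp add: measure_def)
  then show ?case by (simp add: product_kernel_integral_def space_PiM)
next
  case (insert i J)
  define P where "P t = (\<Prod>j\<in>J. sine_kernel N (x j) (t j))" for t
  define W where "W t = override_on x t J" for t
  define T where "T t = (\<integral>y. sine_kernel N (x i) y * F ((W t)(i := y)) \<partial>lborel)" for t
  have [measurable]: "W \<in> Pi\<^sub>M J (\<lambda>_. lborel) \<rightarrow>\<^sub>M Pi\<^sub>M UNIV (\<lambda>_. lborel)"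
    unfolding W_def by (rule measurable_override_on)
  \<comment> \<open>The new coordinate is still untouched, so the kernel centred at
    \<open>x i\<close> is the one that \<open>slice\<close> speaks of.\<close>
  have Wi: "W t i = x i" for t using insert.hyps by (simp add: W_def)
  have slice': "\<bar>T t - F (W t)\<bar> \<le> e" for t
    using slice[of "W t" i] by (simp add: Wi T_def)
  have "(\<lambda>p. (W (fst p))(i := snd p)) \<in> Pi\<^sub>M J (\<lambda>_. lborel) \<Otimes>\<^sub>M lborel \<rightarrow>\<^sub>M Pi\<^sub>M UNIV (\<lambda>_. lborel)"
  proof (rule measurable_PiM_single')
    fix j
    have "(\<lambda>p. W (fst p) j) \<in> Pi\<^sub>M J (\<lambda>_. lborel) \<Otimes>\<^sub>M lborel \<rightarrow>\<^sub>M lborel"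
      by measurable
    then show "(\<lambda>p. ((W (fst p))(i := snd p)) j) \<in> Pi\<^sub>M J (\<lambda>_. lborel) \<Otimes>\<^sub>M lborel \<rightarrow>\<^sub>M lborel"
      by (cases "j = i") auto
  qed auto
  from measurable_compose[OF this F]
  have [measurable]: "(\<lambda>p. F ((W (fst p))(i := snd p))) \<in> borel_measurable (Pi\<^sub>M J (\<lambda>_. lborel) \<Otimes>\<^sub>M lborel)" .
  have T[measurable]: "T \<in> borel_measurable (Pi\<^sub>M J (\<lambda>_. lborel))"
    unfolding T_def
    by (rule sigma_finite_measure.borel_measurable_lebesgue_integral[OF sigma_finite_lborel])
      (simp add: split_beta')
  \<comment> \<open>Boundedness of \<open>T\<close> is inherited from its closeness to
    \<open>F\<close>; it makes the product with the kernels integrable.\<close>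
  have Tbound: "\<bar>T t\<bar> \<le> e + B" for t
    using slice'[of t] bound[of "W t"] by linarith
  have int: "integrable (Pi\<^sub>M J (\<lambda>_. lborel)) (\<lambda>t. P t * T t)"
    "integrable (Pi\<^sub>M J (\<lambda>_. lborel)) (\<lambda>t. P t * F (W t))"
    unfolding P_def
    by (rule product_kernel_times_bounded_integrable[OF insert.hyps(1)], measurable,
        rule Tbound bound)+
  have "product_kernel_integral N (insert i J) F x =
      (\<integral>t. \<integral>y. (\<Prod>j\<in>insert i J. sine_kernel N (x j) ((t(i := y)) j))
        * F (override_on x (t(i := y)) (insert i J)) \<partial>lborel \<partial>Pi\<^sub>M J (\<lambda>_. lborel))"
    unfolding product_kernel_integral_def using insert.hyps
    by (intro lborel_product.product_integral_insert
        product_kernel_times_bounded_integrable[where B = B]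
        measurable_compose[OF measurable_override_on F]) (auto intro: bound)
  also have "\<dots> = (\<integral>t. \<integral>y. P t * (sine_kernel N (x i) y * F ((W t)(i := y))) \<partial>lborel \<partial>Pi\<^sub>M J (\<lambda>_. lborel))"
  proof (intro Bochner_Integration.integral_cong refl)
    fix t y
    have "(\<Prod>j\<in>J. sine_kernel N (x j) ((t(i := y)) j)) = P t"
      unfolding P_def using insert.hyps by (intro prod.cong) auto
    moreover have "override_on x (t(i := y)) (insert i J) = (W t)(i := y)"
      by (auto simp: W_def override_on_def)
    ultimately show "(\<Prod>j\<in>insert i J. sine_kernel N (x j) ((t(i := y)) j))
        * F (override_on x (t(i := y)) (insert i J))
      = P t * (sine_kernel N (x i) y * F ((W t)(i := y)))"
      using insert.hyps by simp
  qed
  also have "\<dots> = (\<integral>t. P t * T t \<partial>Pi\<^sub>M J (\<lambda>_. lborel))" by (simp add: T_def)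
  finally have "product_kernel_integral N (insert i J) F x - product_kernel_integral N J F x
      = (\<integral>t. P t * (T t - F (W t)) \<partial>Pi\<^sub>M J (\<lambda>_. lborel))"
    using int by (simp add: product_kernel_integral_def P_def W_def right_diff_distrib)
  also have "\<bar>\<dots>\<bar> \<le> (\<integral>t. e * (\<Prod>j\<in>J. \<bar>sine_kernel N (x j) (t j)\<bar>) \<partial>Pi\<^sub>M J (\<lambda>_. lborel))"
    unfolding real_norm_def[symmetric]
  proof (rule order.trans[OF integral_norm_bound integral_mono])
    show "integrable (Pi\<^sub>M J (\<lambda>_. lborel)) (\<lambda>t. norm (P t * (T t - F (W t))))"
      using int by (intro integrable_norm) (simp add: right_diff_distrib)
    show "integrable (Pi\<^sub>M J (\<lambda>_. lborel)) (\<lambda>t. e * (\<Prod>j\<in>J. norm (sine_kernel N (x j) (t j))))"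
      using product_kernel_integrable(2)[OF insert.hyps(1), of N x] by simp
    show "norm (P t * (T t - F (W t))) \<le> e * (\<Prod>j\<in>J. norm (sine_kernel N (x j) (t j)))" for t
      using slice'[of t] by (auto simp: P_def abs_mult abs_prod mult.commute intro!: mult_right_mono prod_nonneg)
  qed
  also have "\<dots> \<le> e * (2 * ln (4 * real N + 3)) ^ card J"
  proof -
    have "e \<ge> 0" using slice'[of undefined] by linarith
    then show ?thesis
      using integral_abs_product_kernel_le[OF insert.hyps(1), of N x] by (simp add: mult_left_mono)
  qed
  finally show ?case using insert by (simp add: distrib_left)
qed

lemma error_bound_tendsto_0:
  "(\<lambda>N. M / sqrt (real N) * (\<Sum>k<n. (2 * ln (4 * real N + 3)) ^ k)) \<longlonglongrightarrow> 0"
proof -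
  have "(\<lambda>N. M / sqrt (real N) * (2 * ln (4 * real N + 3)) ^ k) \<longlonglongrightarrow> 0" for k
    by real_asymp
  then have "(\<lambda>N. \<Sum>k<n. M / sqrt (real N) * (2 * ln (4 * real N + 3)) ^ k) \<longlonglongrightarrow> 0"
    by (rule tendsto_null_sum)
  then show ?thesis by (simp add: sum_distrib_left)
qed

subsection \<open>Lebesgue measure and coordinates\<close>

lemma prod_Basis_cart:
  fixes a :: "real ^ 'n::finite"
  shows "(\<Prod>b\<in>Basis. a \<bullet> b) = (\<Prod>i\<in>UNIV. a $ i)"
proof -
  have B: "(Basis :: (real ^ 'n) set) = range (\<lambda>i. axis i 1)"
    by (auto simp: Basis_vec_def)
  have "inj (\<lambda>i :: 'n. axis i (1::real))"
    by (auto intro!: injI simp: axis_eq_axis)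
  then have "(\<Prod>b\<in>Basis. a \<bullet> b) = (\<Prod>i\<in>UNIV. a \<bullet> axis i 1)"
    unfolding B by (subst prod.reindex) (auto simp: comp_def)
  then show ?thesis by (simp add: cart_eq_inner_axis)
qed

lemma le_Basis_cart:
  fixes l u :: "real ^ 'n::finite"
  shows "(\<forall>b\<in>Basis. l \<bullet> b \<le> u \<bullet> b) \<longleftrightarrow> (\<forall>i. l $ i \<le> u $ i)"
  by (auto simp: Basis_vec_def cart_eq_inner_axis)

lemma measurable_vec_lambda:
  "vec_lambda \<in> Pi\<^sub>M UNIV (\<lambda>_. lborel) \<rightarrow>\<^sub>M (borel :: (real ^ 'n::finite) measure)"
proof (rule borel_measurable_euclidean_space[THEN iffD2], rule ballI)
  fix b :: "real ^ 'n" assume "b \<in> Basis"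
  then obtain i where b: "b = axis i 1" by (auto simp: Basis_vec_def)
  have "(\<lambda>x. x i) \<in> borel_measurable (Pi\<^sub>M UNIV (\<lambda>_::'n. lborel :: real measure))"
    using measurable_component_singleton[of i UNIV "\<lambda>_::'n. lborel :: real measure"] by simp
  then show "(\<lambda>x. vec_lambda x \<bullet> b) \<in> borel_measurable (Pi\<^sub>M UNIV (\<lambda>_. lborel))"
    by (simp add: b flip: cart_eq_inner_axis)
qed

text \<open>Lebesgue measure is determined by the volumes of boxes, and the preimage of a box is a
  product of intervals. This moves integrals between vectors and index functions.\<close>

lemma lborel_eq_distr_vec_lambda:
  "(lborel :: (real ^ 'n::finite) measure) = distr (Pi\<^sub>M UNIV (\<lambda>_. lborel)) borel vec_lambda"
proof (rule lborel_eqI)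
  fix l u :: "real ^ 'n" assume "\<And>b. b \<in> Basis \<Longrightarrow> l \<bullet> b \<le> u \<bullet> b"
  then have le: "l $ i \<le> u $ i" for i using le_Basis_cart by blast
  have "vec_lambda -` box l u \<inter> space (Pi\<^sub>M UNIV (\<lambda>_::'n. lborel :: real measure))
      = Pi\<^sub>E UNIV (\<lambda>i. {l $ i<..<u $ i})"
    by (auto simp: space_PiM mem_box_cart PiE_def Pi_iff)
  then have "emeasure (distr (Pi\<^sub>M UNIV (\<lambda>_. lborel)) borel vec_lambda) (box l u)
      = (\<Prod>i\<in>UNIV. emeasure lborel {l $ i<..<u $ i})"
    by (subst emeasure_distr[OF measurable_vec_lambda])
      (auto simp: lborel_product.emeasure_PiM)
  also have "\<dots> = ennreal (\<Prod>i\<in>UNIV. (u - l) $ i)"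
    using le by (simp add: prod_ennreal)
  finally show "emeasure (distr (Pi\<^sub>M UNIV (\<lambda>_. lborel)) borel vec_lambda) (box l u)
      = ennreal (\<Prod>b\<in>Basis. (u - l) \<bullet> b)"
    by (simp only: prod_Basis_cart)
qed simp

lemma perm_act_measurable [measurable]: "perm_act w \<in> borel_measurable borel"
  unfolding perm_act_def
  by (intro borel_measurable_continuous_onI continuous_intros)

lemma lborel_distr_perm_act:
  assumes "w permutes (UNIV :: 'n::finite set)"
  shows "distr lborel borel (perm_act w) = (lborel :: (real ^ 'n) measure)"
proof (rule lborel_eqI[symmetric])
  fix l u :: "real ^ 'n" assume "\<And>b. b \<in> Basis \<Longrightarrow> l \<bullet> b \<le> u \<bullet> b"
  then have le: "l $ i \<le> u $ i" for i using le_Basis_cart by blast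
  \<comment> \<open>The preimage of a box under \<open>perm_act w\<close> is the box whose corners
    are permuted by the inverse.\<close>
  define v where "v = inv w"
  have v: "v permutes UNIV" "w (v i) = i" "v (w i) = i" for i
    using assms by (simp_all add: v_def permutes_inv permutes_inverses)
  have "perm_act w -` box l u = box (perm_act v l) (perm_act v u)"
  proof (intro set_eqI)
    fix x
    have "(\<forall>i. l $ i < x $ w i \<and> x $ w i < u $ i) \<longleftrightarrow>
        (\<forall>i. l $ v i < x $ i \<and> x $ i < u $ v i)"
      by (metis v(2,3))
    then show "x \<in> perm_act w -` box l u \<longleftrightarrow> x \<in> box (perm_act v l) (perm_act v u)"
      by (simp add: mem_box_cart perm_act_def)
  qed
  then have "emeasure (distr lborel borel (perm_act w)) (box l u)
      = emeasure lborel (box (perm_act v l) (perm_act v u))"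
    by (subst emeasure_distr) auto
  also have "\<dots> = ennreal (\<Prod>b\<in>Basis. (perm_act v u - perm_act v l) \<bullet> b)"
  proof (rule emeasure_lborel_box)
    have "\<forall>b\<in>Basis. perm_act v l \<bullet> b \<le> perm_act v u \<bullet> b"
      unfolding le_Basis_cart using le by (simp add: perm_act_def)
    then show "perm_act v l \<bullet> b \<le> perm_act v u \<bullet> b" if "b \<in> Basis" for b
      using that by blast
  qed
  also have "(\<Prod>b\<in>Basis. (perm_act v u - perm_act v l) \<bullet> b) = (\<Prod>i\<in>UNIV. (u - l) $ v i)"
    unfolding prod_Basis_cart by (simp add: perm_act_def)
  also have "\<dots> = (\<Prod>i\<in>UNIV. (u - l) $ i)"
    using prod.permute[OF v(1), of "\<lambda>i. (u - l) $ i"] by (simp add: comp_def)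
  finally show "emeasure (distr lborel borel (perm_act w)) (box l u)
      = ennreal (\<Prod>b\<in>Basis. (u - l) \<bullet> b)"
    by (simp only: prod_Basis_cart)
qed simp

lemma lborel_integral_perm_act:
  fixes g :: "real ^ 'n::finite \<Rightarrow> real"
  assumes "w permutes UNIV" and "g \<in> borel_measurable borel"
  shows "(\<integral>x. g (perm_act w x) \<partial>lborel) = (\<integral>x. g x \<partial>lborel)"
    "integrable lborel g \<Longrightarrow> integrable lborel (\<lambda>x. g (perm_act w x))"
proof -
  show "(\<integral>x. g (perm_act w x) \<partial>lborel) = (\<integral>x. g x \<partial>lborel)"
    using integral_distr[of "perm_act w" lborel borel g] assms
    by (simp add: lborel_distr_perm_act)
  show "integrable lborel (\<lambda>x. g (perm_act w x))" if "integrable lborel g"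
    using integrable_distr_eq[of "perm_act w" lborel borel g] assms that
    by (simp add: lborel_distr_perm_act)
qed

subsection \<open>Sorting permutations\<close>

text \<open>The sorting permutation matches the rank of \<open>v j\<close>, counted from the top, with the rank of
  the index; for uniqueness, any sorting permutation has to match these ranks.\<close>

lemma ex1_sorting_permutation:
  fixes v :: "'n::{finite,linorder} \<Rightarrow> 'a::linorder"
  assumes "inj v"
  shows "\<exists>!w. w permutes UNIV \<and> (\<forall>i j. i < j \<longrightarrow> v (w j) < v (w i))"
proof -
  define rk where "rk i = card {j. j < i}" for i :: 'n
  define rv where "rv i = card {j. v i < v j}" for i
  have rk_less: "rk i < rk j" if "i < j" for i j
    unfolding rk_def using that by (intro psubset_card_mono) auto
  have rv_less: "rv j < rv i" if "v i < v j" for i j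
    unfolding rv_def using that by (intro psubset_card_mono) auto
  have inj_rk: "inj rk"
    by (rule linorder_injI) (use rk_less in fastforce)
  have inj_rv: "inj rv"
  proof (rule injI, rule ccontr)
    fix i j assume "rv i = rv j" "i \<noteq> j"
    then have "v i \<noteq> v j" using assms by (simp add: inj_eq)
    then consider "v i < v j" | "v j < v i" by (rule linorder_neqE)
    then show False using rv_less[of i j] rv_less[of j i] \<open>rv i = rv j\<close> by cases auto
  qed
  \<comment> \<open>No index is counted in its own rank, so ranks are below n; injectivity then
    makes both rank functions bijections onto the numbers below n.\<close>
  have sub: "range rk \<subseteq> {..<CARD('n)}" "range rv \<subseteq> {..<CARD('n)}"
    unfolding rk_def rv_def by (auto intro!: psubset_card_mono)
  have "card (range rk) = CARD('n)" "card (range rv) = CARD('n)"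
    using inj_rk inj_rv by (simp_all add: card_image)
  then have range: "range rk = {..<CARD('n)}" "range rv = {..<CARD('n)}"
    using sub by (simp_all add: card_subset_eq)
  show ?thesis
  proof (rule ex1I)
    define w where "w = inv rv \<circ> rk"
    have w: "rv (w i) = rk i" for i
      unfolding w_def comp_def using range by (intro f_inv_into_f) auto
    have "inj w" using w inj_rk by (metis injD injI)
    then have "bij w" by (simp add: bij_def finite_UNIV_inj_surj)
    then have "w permutes UNIV" by (intro bij_imp_permutes) auto
    moreover have "v (w j) < v (w i)" if "i < j" for i j
    proof (rule ccontr)
      assume "\<not> v (w j) < v (w i)"
      moreover have "v (w i) \<noteq> v (w j)"
        using that \<open>inj w\<close> assms by (auto simp: inj_eq)
      ultimately have "rv (w j) < rv (w i)" by (intro rv_less) simp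
      with rk_less[OF that] show False by (simp add: w)
    qed
    ultimately show "w permutes UNIV \<and> (\<forall>i j. i < j \<longrightarrow> v (w j) < v (w i))" by blast
  next
    fix u assume u: "u permutes UNIV \<and> (\<forall>i j. i < j \<longrightarrow> v (u j) < v (u i))"
    have *: "rv (u i) = rk i" for i
    proof -
      have less: "v (u i) < v (u j) \<longleftrightarrow> j < i" for j
        using u by (cases i j rule: linorder_cases) (auto dest: less_asym)
      have "{j. v (u i) < v j} = u ` {j. j < i}"
      proof -
        have "surj u" using u permutes_surj by blast
        show ?thesis
        proof (intro set_eqI iffI)
          fix j assume "j \<in> {j. v (u i) < v j}"
          moreover obtain k where "j = u k" using \<open>surj u\<close> by (rule surjE)
          ultimately show "j \<in> u ` {j. j < i}" using less by auto
        qed (use less in auto)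
      qed
      then show ?thesis
        unfolding rv_def rk_def using u by (metis card_image permutes_inj_on)
    qed
    show "u = inv rv \<circ> rk"
    proof
      fix i
      have "inv rv (rv (u i)) = u i" by (rule inv_f_f[OF inj_rv])
      then show "u i = (inv rv \<circ> rk) i" by (simp only: * comp_def)
    qed
  qed
qed

text \<open>Exactly one summand survives. Read backwards, this inserts a sum over permutations, once
  for the coordinates of a point and once for the entries of a multi-index.\<close>

lemma sum_sorting_permutations:
  fixes v :: "'n::{finite,linorder} \<Rightarrow> 'a::linorder"
  assumes "inj v"
  shows "(\<Sum>w | w permutes UNIV. if \<forall>i j. i < j \<longrightarrow> v (w j) < v (w i) then c else 0)
    = (c :: 'b::comm_monoid_add)"
proof -
  from ex1_sorting_permutation[OF assms] obtain u where
    u: "u permutes UNIV" "\<forall>i j. i < j \<longrightarrow> v (u j) < v (u i)"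
    and uniq: "\<And>w. w permutes UNIV \<Longrightarrow> \<forall>i j. i < j \<longrightarrow> v (w j) < v (w i) \<Longrightarrow> w = u" by metis
  have "(\<forall>i j. i < j \<longrightarrow> v (w j) < v (w i)) \<longleftrightarrow> w = u" if "w permutes UNIV" for w
    using u(2) uniq[OF that] by blast
  then have "(\<Sum>w | w permutes UNIV. if \<forall>i j. i < j \<longrightarrow> v (w j) < v (w i) then c else 0)
      = (\<Sum>w | w permutes UNIV. if w = u then c else 0)"
    by (intro sum.cong) simp_all
  also have "\<dots> = c" using u(1) by (simp add: finite_permutations)
  finally show ?thesis .
qed

subsection \<open>Symmetrization\<close>

definition sine_product :: "int ^ 'n \<Rightarrow> real ^ 'n::finite \<Rightarrow> real" where
  "sine_product m x = (\<Prod>i\<in>UNIV. sin (2 * pi * real_of_int (m $ i) * x $ i))"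

lemma continuous_on_sine_product [continuous_intros]: "continuous_on A (sine_product m)"
  unfolding sine_product_def[abs_def] by (intro continuous_intros)

text \<open>The Leibniz expansion with the permutation acting on the point, as needed under the
  integral.\<close>

lemma sin_minus_eq_sum_perm_act:
  "sin_minus m x = (\<Sum>w | w permutes UNIV. of_int (sign w) * sine_product m (perm_act w x))"
  by (simp add: sin_minus_def det_def sine_product_def perm_act_def)

text \<open>The Leibniz expansion of the transposed matrix, where the permutation acts on the
  multi-index, as needed for summation over \<open>m\<close>.\<close>

lemma sin_minus_eq_sum_perm_index:
  "sin_minus m x = (\<Sum>w | w permutes UNIV. of_int (sign w) * sine_product (\<chi> i. m $ w i) x)"
proof -
  have "sin_minus m x = det (transpose (\<chi> i j. sin (2 * pi * real_of_int (m $ i) * x $ j)))"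
    by (simp add: sin_minus_def)
  then show ?thesis by (simp only: det_def sine_product_def) (simp add: transpose_def)
qed

lemma sin_minus_permute_index:
  assumes "w permutes UNIV"
  shows "sin_minus (\<chi> i. m $ w i) x = of_int (sign w) * sin_minus m x"
  using det_permute_rows[OF assms, of "\<chi> i j. sin (2 * pi * real_of_int (m $ i) * x $ j)"]
  by (simp add: sin_minus_def)

lemma sin_minus_eq_0:
  assumes "\<not> inj (($) m)"
  shows "sin_minus m x = 0"
proof -
  from assms obtain i j where ij: "i \<noteq> j" "m $ i = m $ j" by (auto simp: inj_def)
  show ?thesis unfolding sin_minus_def
    by (rule det_identical_rows[OF ij(1)]) (simp add: row_def ij(2))
qed

lemma continuous_on_sin_minus [continuous_intros]: "continuous_on A (sin_minus m)"
  unfolding sin_minus_def[abs_def] det_def by (intro continuous_intros)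

section \<open>Tiling of the half cube by the fundamental domain, up to null sets\<close>

lemma AE_lborel_not_hyperplane:
  fixes a :: "'a::euclidean_space"
  assumes "a \<noteq> 0"
  shows "AE x in lborel. a \<bullet> x \<noteq> c"
proof -
  have "closed {x. a \<bullet> x = c}" by (rule closed_hyperplane)
  moreover have "{x. a \<bullet> x = c} \<in> null_sets lebesgue"
    using negligible_hyperplane[of a c] assms by (simp add: negligible_iff_null_sets)
  ultimately have "{x. a \<bullet> x = c} \<in> null_sets lborel"
    using null_sets_completion_iff[of "{x. a \<bullet> x = c}" lborel] by simp
  from AE_not_in[OF this] show ?thesis by simp
qed

text \<open>Finitely many hyperplanes are excluded. Off them sorting is unambiguous and weak
  inequalities between coordinates, or against 0 and 1/2, are strict.\<close>

lemma AE_lborel_inj_component: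
  "AE x in lborel. inj (($) (x :: real ^ 'n::finite)) \<and> (\<forall>i. x $ i \<noteq> 0 \<and> x $ i \<noteq> 1/2)"
proof -
  have c: "AE x in lborel. x $ i \<noteq> c" for i :: 'n and c :: real
    using AE_lborel_not_hyperplane[of "axis i (1::real)" c] by (simp add: axis_eq_0_iff inner_axis')
  have "AE x in lborel. (x :: real ^ 'n) $ i \<noteq> x $ j" if "i \<noteq> j" for i j
  proof -
    have "axis i (1::real) - axis j 1 \<noteq> 0" using that by (simp add: axis_eq_axis)
    from AE_lborel_not_hyperplane[OF this, of 0] show ?thesis
      by eventually_elim (simp add: inner_diff_left inner_axis')
  qed
  then have "AE x in lborel. \<forall>p\<in>UNIV. fst p \<noteq> snd p \<longrightarrow> (x :: real ^ 'n) $ fst p \<noteq> x $ snd (p :: 'n \<times> 'n)"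
    by (intro AE_finite_allI) auto
  moreover have "AE x in lborel. \<forall>i\<in>UNIV. x $ i \<noteq> 0 \<and> x $ (i :: 'n) \<noteq> (1/2 :: real)"
    by (intro AE_finite_allI AE_conjI c) auto
  ultimately show ?thesis by eventually_elim (auto simp: inj_def)
qed

definition half_cube :: "(real ^ 'n::finite) set" where
  "half_cube = {x. \<forall>i. 0 \<le> x $ i \<and> x $ i \<le> 1/2}"

lemma half_cube_eq_cbox: "half_cube = cbox 0 (\<chi> i. 1/2)"
  by (auto simp: half_cube_def mem_box_cart)

lemma fund_domain_subset:
  fixes x :: "real ^ 'n::{finite,linorder}"
  shows "(closure fund_domain :: (real ^ 'n::{finite,linorder}) set) \<subseteq> half_cube"
    and "x \<in> closure fund_domain \<Longrightarrow> i < j \<Longrightarrow> x $ j \<le> x $ i"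
proof -
  have "closed {x :: real ^ 'n::{finite,linorder}. x $ j \<le> x $ i}" for i j
    by (intro closed_Collect_le continuous_intros)
  moreover have "fund_domain \<subseteq> {x. x $ j \<le> x $ i}" if "i < j" for i j :: 'n
    using that by (auto simp: fund_domain_def less_imp_le)
  ultimately have "closure fund_domain \<subseteq> {x :: real ^ 'n::{finite,linorder}. x $ j \<le> x $ i}" if "i < j"
    using that by (intro closure_minimal)
  then show "x \<in> closure fund_domain \<Longrightarrow> i < j \<Longrightarrow> x $ j \<le> x $ i" by auto
  have "(fund_domain :: (real ^ 'n::{finite,linorder}) set) \<subseteq> half_cube"
    by (auto simp: fund_domain_def half_cube_def less_imp_le)
  then show "(closure fund_domain :: (real ^ 'n::{finite,linorder}) set) \<subseteq> half_cube"
    by (rule closure_minimal) (simp only: half_cube_eq_cbox closed_cbox)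
qed

lemma fund_domain_borel [measurable]: "(fund_domain :: (real ^ 'n::{finite,linorder}) set) \<in> sets borel"
proof -
  have eq: "(fund_domain :: (real ^ 'n::{finite,linorder}) set) = (\<Inter>i. {x. 0 < x $ i} \<inter> {x. x $ i < 1/2}) \<inter>
      (\<Inter>p\<in>{p. fst p < snd p}. {x. x $ snd p < x $ fst p})"
    by (auto simp: fund_domain_def)
  have "open (fund_domain :: (real ^ 'n::{finite,linorder}) set)"
    unfolding eq by (intro open_Int open_INT ballI open_Collect_less continuous_intros) auto
  then show ?thesis by simp
qed

lemma AE_closure_fund_domain: "AE x in lborel. x \<in> closure fund_domain \<longleftrightarrow> x \<in> fund_domain"
  using AE_lborel_inj_component
proof eventually_elim
  case (elim x)
  have "x \<in> fund_domain" if "x \<in> closure fund_domain"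
  proof -
    have "x \<in> half_cube" using that fund_domain_subset(1) by blast
    then have "0 < x $ i \<and> x $ i < 1/2" for i
      using elim by (auto simp: half_cube_def less_le)
    moreover have "x $ j < x $ i" if "i < j" for i j
      using fund_domain_subset(2)[OF \<open>x \<in> closure fund_domain\<close> that] elim that
      by (auto simp: less_le inj_eq)
    ultimately show ?thesis by (simp add: fund_domain_def)
  qed
  then show ?case using closure_subset by blast
qed

text \<open>For a generic point of the cube exactly one permutation sorts the coordinates into
  decreasing order.\<close>

lemma AE_half_cube_eq_sum_perm_act:
  "AE x in lborel. indicator half_cube x =
     (\<Sum>w | w permutes (UNIV :: 'n::{finite,linorder} set). indicator fund_domain (perm_act w x) :: real)"
  using AE_lborel_inj_component
proof eventually_elim
  case (elim x)
  have "indicator fund_domain (perm_act w x) =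
      (if \<forall>i j. i < j \<longrightarrow> x $ w j < x $ w i then indicator half_cube x else 0 :: real)"
    if "w permutes UNIV" for w :: "'n \<Rightarrow> 'n"
  proof -
    have "(\<forall>i. 0 < x $ w i \<and> x $ w i < 1/2) \<longleftrightarrow> (\<forall>i. 0 < x $ i \<and> x $ i < 1/2)"
      using that by (metis permutes_inverses(1))
    also have "\<dots> \<longleftrightarrow> x \<in> half_cube"
      using elim by (auto simp: half_cube_def less_le)
    finally show ?thesis by (auto simp: fund_domain_def perm_act_def indicator_def)
  qed
  then show ?case
    using sum_sorting_permutations[of "($) x" "indicator half_cube x :: real"] elim by simp
qed

lemma integrable_indicator_times_continuous:
  fixes h :: "real ^ 'n::finite \<Rightarrow> real"
  assumes "continuous_on UNIV h" "S \<in> sets borel" "S \<subseteq> half_cube"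
  shows "integrable lborel (\<lambda>x. indicator S x * h x)"
proof -
  have "continuous_on half_cube h" using assms(1) continuous_on_subset by blast
  then have "set_integrable lborel half_cube h"
    unfolding set_integrable_def half_cube_eq_cbox by (intro borel_integrable_compact) auto
  then have "set_integrable lborel S h"
    by (rule set_integrable_subset) (use assms in auto)
  then show ?thesis by (simp add: set_integrable_def)
qed

lemma continuous_on_perm_act [continuous_intros]: "continuous_on A (perm_act w)"
  unfolding perm_act_def[abs_def] by (intro continuous_intros)

text \<open>Cut the cube into permuted copies of the fundamental domain and map each one back.
  Antisymmetry of \<open>f\<close> supplies the sign, and the signed sine products add up to the
  determinant.\<close>

lemma integral_half_cube_eq_fund_domain:
  fixes f :: "real ^ 'n::{finite,linorder} \<Rightarrow> real"
  assumes cont: "continuous_on UNIV f"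
    and anti: "\<And>w x. w permutes UNIV \<Longrightarrow> f (perm_act w x) = of_int (sign w) * f x"
  shows "(\<integral>x. indicator half_cube x * (f x * sine_product m x) \<partial>lborel)
    = (LINT x:closure fund_domain|lborel. f x * sin_minus m x)"
proof -
  define G where "G w x = indicator fund_domain x * (of_int (sign w) * f x * sine_product m (perm_act w x))"
    for w :: "'n \<Rightarrow> 'n" and x
  have sub: "fund_domain \<subseteq> half_cube" using fund_domain_subset(1) closure_subset by blast
  have int: "integrable lborel (G w)" for w
    unfolding G_def
    by (intro integrable_indicator_times_continuous sub fund_domain_borel continuous_intros cont
        continuous_on_compose2[OF continuous_on_sine_product[of UNIV]]) auto
  have meas: "G w \<in> borel_measurable borel" for w
    using borel_measurable_integrable[OF int] by simp
  \<comment> \<open>Everything is expressed through \<open>perm_act w x\<close>, so that the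
    measure-preserving substitution applies; the inverse is removed afterwards by reindexing the
    sum.\<close>
  have eq: "indicator fund_domain (perm_act w x) * (f x * sine_product m x) = G (inv w) (perm_act w x)"
    if "w permutes UNIV" for w x
  proof -
    have "perm_act (inv w) (perm_act w x) = x"
      using that by (simp add: perm_act_def permutes_inverses)
    moreover have "f (perm_act (inv w) (perm_act w x)) = of_int (sign (inv w)) * f (perm_act w x)"
      using that by (intro anti permutes_inv)
    ultimately show ?thesis by (simp add: G_def)
  qed
  have "(\<integral>x. indicator half_cube x * (f x * sine_product m x) \<partial>lborel)
      = (\<integral>x. (\<Sum>w | w permutes UNIV. G (inv w) (perm_act w x)) \<partial>lborel)"
  proof (rule integral_cong_AE)
    show "AE x in lborel. indicator half_cube x * (f x * sine_product m x)
        = (\<Sum>w | w permutes UNIV. G (inv w) (perm_act w x))"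
      using AE_half_cube_eq_sum_perm_act
      by eventually_elim (simp add: sum_distrib_right eq)
    show "(\<lambda>x. indicator half_cube x * (f x * sine_product m x)) \<in> borel_measurable lborel"
      by (intro borel_measurable_integrable integrable_indicator_times_continuous continuous_intros cont)
        (auto simp: half_cube_eq_cbox)
    show "(\<lambda>x. \<Sum>w | w permutes UNIV. G (inv w) (perm_act w x)) \<in> borel_measurable lborel"
      by (intro borel_measurable_sum borel_measurable_integrable lborel_integral_perm_act(2) meas int)
        auto
  qed
  also have "\<dots> = (\<Sum>w | w permutes UNIV. \<integral>x. G (inv w) (perm_act w x) \<partial>lborel)"
    by (intro Bochner_Integration.integral_sum lborel_integral_perm_act(2) meas int) auto
  also have "\<dots> = (\<Sum>w | w permutes UNIV. \<integral>x. G (inv w) x \<partial>lborel)"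
    by (intro sum.cong refl lborel_integral_perm_act(1) meas) auto
  also have "\<dots> = (\<Sum>w | w permutes UNIV. \<integral>x. G w x \<partial>lborel)"
    by (rule sum_permutations_inverse[symmetric])
  also have "\<dots> = (\<integral>x. (\<Sum>w | w permutes UNIV. G w x) \<partial>lborel)"
    using int by (intro Bochner_Integration.integral_sum[symmetric])
  also have "\<dots> = (\<integral>x. indicator fund_domain x * (f x * sin_minus m x) \<partial>lborel)"
    by (simp add: G_def sin_minus_eq_sum_perm_act sum_distrib_left mult_ac)
  also have "\<dots> = (\<integral>x. indicator (closure fund_domain) x * (f x * sin_minus m x) \<partial>lborel)"
  proof (rule integral_cong_AE)
    show "AE x in lborel. indicator fund_domain x * (f x * sin_minus m x)
        = indicator (closure fund_domain) x * (f x * sin_minus m x)"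
      using AE_closure_fund_domain by eventually_elim (simp add: indicator_def)
  qed (intro borel_measurable_integrable integrable_indicator_times_continuous continuous_intros cont
        fund_domain_borel sub fund_domain_subset; simp)+
  finally show ?thesis by (simp add: set_lebesgue_integral_def)
qed

section \<open>Sums over boxes of multi-indices\<close>

lemma finite_int_vec_box: "finite {m :: int ^ 'n::finite. \<forall>i. 1 \<le> m $ i \<and> m $ i \<le> int N}"
proof (rule finite_subset)
  show "{m :: int ^ 'n. \<forall>i. 1 \<le> m $ i \<and> m $ i \<le> int N} \<subseteq> vec_lambda ` (Pi\<^sub>E UNIV (\<lambda>_. {1..int N}))"
    by (auto intro!: image_eqI[where x = "($) _"] simp: PiE_def)
  show "finite (vec_lambda ` (Pi\<^sub>E (UNIV :: 'n set) (\<lambda>_. {1..int N})))"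
    by (intro finite_imageI finite_PiE) auto
qed

text \<open>The discrete counterpart of folding the cube: the index box is permutation invariant,
  indices with repeated entries drop out, and each remaining one is sorted into
  \<open>P_plus\<close> by exactly one permutation.\<close>

lemma sum_antisymmetric_times_sine_product:
  fixes a :: "int ^ 'n::{finite,linorder} \<Rightarrow> real"
  assumes anti: "\<And>w m. w permutes UNIV \<Longrightarrow> a (\<chi> i. m $ w i) = of_int (sign w) * a m"
    and zero: "\<And>m. \<not> inj (($) m) \<Longrightarrow> a m = 0"
  shows "(\<Sum>m | \<forall>i. 1 \<le> m $ i \<and> m $ i \<le> int N. a m * sine_product m x)
    = (\<Sum>m\<in>{m\<in>P_plus. \<forall>i. m $ i \<le> int N}. a m * sin_minus m x)"
proof -
  define I where "I = {m :: int ^ 'n::{finite,linorder}. \<forall>i. 1 \<le> m $ i \<and> m $ i \<le> int N}"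
  define p where "p w m = (\<chi> i. m $ w i)" for w :: "'n \<Rightarrow> 'n" and m :: "int ^ 'n::{finite,linorder}"
  have p: "p (inv w) (p w m) = m" "p w (p (inv w) m) = m" if "w permutes UNIV" for w m
    using that by (simp_all add: p_def permutes_inverses)
  have pI: "p w m \<in> I" if "m \<in> I" for w m using that by (simp add: I_def p_def)
  have "finite I" unfolding I_def by (rule finite_int_vec_box)
  \<comment> \<open>Entries of box indices are positive, so only the ordering condition of
    \<open>P_plus\<close> remains.\<close>
  have P: "p w m \<in> P_plus \<longleftrightarrow> (\<forall>i j. i < j \<longrightarrow> m $ w j < m $ w i)" if "m \<in> I" for w m
    using pI[OF that, of w] by (auto simp: P_plus_def p_def I_def) (metis zero_less_one order.strict_trans2)
  have "(\<Sum>m\<in>I. a m * sine_product m x)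
      = (\<Sum>m\<in>I. \<Sum>w | w permutes UNIV. if p w m \<in> P_plus then a m * sine_product m x else 0)"
  proof (intro sum.cong refl)
    fix m assume m: "m \<in> I"
    show "a m * sine_product m x
        = (\<Sum>w | w permutes UNIV. if p w m \<in> P_plus then a m * sine_product m x else 0)"
    proof (cases "inj (($) m)")
      case True
      then show ?thesis
        using sum_sorting_permutations[of "($) m" "a m * sine_product m x"] by (simp add: P[OF m])
    qed (simp add: zero cong: if_cong)
  qed
  also have "\<dots> = (\<Sum>w | w permutes UNIV. \<Sum>m\<in>I. if p w m \<in> P_plus then a m * sine_product m x else 0)"
    by (rule sum.swap)
  also have "\<dots> = (\<Sum>w | w permutes UNIV. \<Sum>m\<in>I. if m \<in> P_plus
      then a (p (inv w) m) * sine_product (p (inv w) m) x else 0)"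
  proof (rule sum.cong[OF refl])
    fix w assume w: "w \<in> {w. w permutes (UNIV :: 'n set)}"
    show "(\<Sum>m\<in>I. if p w m \<in> P_plus then a m * sine_product m x else 0) = (\<Sum>m\<in>I. if m \<in> P_plus
        then a (p (inv w) m) * sine_product (p (inv w) m) x else 0)"
      by (rule sum.reindex_bij_witness[of _ "p (inv w)" "p w"]) (use w p pI in auto)
  qed
  also have "\<dots> = (\<Sum>w | w permutes UNIV. \<Sum>m\<in>I. if m \<in> P_plus
      then a (p w m) * sine_product (p w m) x else 0)"
    by (rule sum_permutations_inverse[symmetric])
  also have "\<dots> = (\<Sum>m\<in>I. \<Sum>w | w permutes UNIV. if m \<in> P_plus
      then a (p w m) * sine_product (p w m) x else 0)"
    by (rule sum.swap)
  also have "\<dots> = (\<Sum>m\<in>I. if m \<in> P_plus then a m * sin_minus m x else 0)"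
    by (intro sum.cong refl)
      (simp add: p_def anti sin_minus_eq_sum_perm_index sum_distrib_left mult_ac)
  also have "\<dots> = (\<Sum>m\<in>{m\<in>I. m \<in> P_plus}. a m * sin_minus m x)"
    using \<open>finite I\<close> by (simp add: sum.inter_filter)
  also have "{m\<in>I. m \<in> P_plus} = {m\<in>P_plus. \<forall>i. m $ i \<le> int N}"
    by (auto simp: I_def P_plus_def int_one_le_iff_zero_less)
  finally show ?thesis by (simp add: I_def)
qed

text \<open>Distributivity turns the product of one-dimensional sums into a sum over the index box.
  Each coordinate brings a factor 4, the inverse of the integral of sin^2 over [0, 1/2].\<close>

lemma prod_sine_kernel_eq:
  fixes x t :: "real ^ 'n::finite"
  shows "(\<Prod>i\<in>UNIV. sine_kernel N (x $ i) (t $ i)) = indicator half_cube t *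
    (\<Sum>m | \<forall>i. 1 \<le> m $ i \<and> m $ i \<le> int N. 4 ^ CARD('n) * (sine_product m x * sine_product m t))"
proof -
  have nat1: "Suc 0 \<le> nat z \<longleftrightarrow> 1 \<le> z" for z by linarith
  define T where "T i k = 4 * (sin (2 * pi * real k * x $ i) * sin (2 * pi * real k * t $ i))"
    for i :: 'n and k :: nat
  have "(\<Prod>i\<in>UNIV. sine_kernel N (x $ i) (t $ i))
      = (\<Prod>i\<in>UNIV. indicator {0..1/2} (t $ i)) * (\<Prod>i\<in>UNIV. \<Sum>k=1..N. T i k)"
    by (simp add: sine_kernel_def T_def prod.distrib)
  also have "(\<Prod>i\<in>UNIV. indicator {0..1/2} (t $ i)) = (indicator half_cube t :: real)"
  proof (cases "t \<in> half_cube")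
    case True
    then show ?thesis by (simp add: half_cube_def)
  next
    case False
    then obtain i where "t $ i \<notin> {0..1/2}" by (auto simp: half_cube_def)
    then have "(\<Prod>i\<in>UNIV. indicator {0..1/2} (t $ i)) = (0 :: real)"
      by (intro prod_zero) (auto simp: indicator_def)
    with False show ?thesis by simp
  qed
  also have "(\<Prod>i\<in>UNIV. \<Sum>k=1..N. T i k) = (\<Sum>g\<in>Pi\<^sub>E UNIV (\<lambda>_. {1..N}). \<Prod>i\<in>UNIV. T i (g i))"
    by (rule prod_sum_PiE) auto
  also have "\<dots> = (\<Sum>m | \<forall>i. 1 \<le> m $ i \<and> m $ i \<le> int N. \<Prod>i\<in>UNIV. T i (nat (m $ i)))"
    by (rule sum.reindex_bij_witness[of _ "\<lambda>m i. nat (m $ i)" "\<lambda>g. \<chi> i. int (g i)"])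
      (auto simp: nat1 vec_eq_iff PiE_def Pi_iff nat_le_iff le_nat_iff fun_eq_iff
        intro: order.trans[OF zero_le_one])
  also have "\<dots> = (\<Sum>m | \<forall>i. 1 \<le> m $ i \<and> m $ i \<le> int N.
      4 ^ CARD('n) * (sine_product m x * sine_product m t))"
  proof (rule sum.cong[OF refl])
    fix m :: "int ^ 'n" assume "m \<in> {m. \<forall>i. 1 \<le> m $ i \<and> m $ i \<le> int N}"
    then have "0 \<le> m $ i" for i by (auto intro: order.trans[OF zero_le_one])
    then show "(\<Prod>i\<in>UNIV. T i (nat (m $ i))) = 4 ^ CARD('n) * (sine_product m x * sine_product m t)"
      by (simp add: T_def sine_product_def prod.distrib)
  qed
  finally show ?thesis .
qed

subsection \<open>Convergence and Plancherel formula\<close>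

lemma sin_minus_coeff_permute_index:
  assumes "w permutes UNIV"
  shows "sin_minus_coeff f (\<chi> i. m $ w i) = of_int (sign w) * sin_minus_coeff f m"
proof -
  have "f x * sin_minus (\<chi> i. m $ w i) x = of_int (sign w) * (f x * sin_minus m x)" for x
    by (simp only: sin_minus_permute_index[OF assms]) simp
  then show ?thesis by (simp only: sin_minus_coeff_def set_integral_mult_right) simp
qed

lemma sin_minus_coeff_eq_0: "\<not> inj (($) m) \<Longrightarrow> sin_minus_coeff f m = 0"
  by (simp add: sin_minus_coeff_def sin_minus_eq_0)

text \<open>Expanding the product kernel gives the multiple sine series on the half cube. Its
  integrals fold to the fundamental domain, its index box folds to \<open>P_plus\<close>, and the
  factor 4^n is the 2^(2n) of the coefficients.\<close>

lemma product_kernel_integral_eq_partial_sum: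
  fixes f :: "real ^ 'n::{finite,linorder} \<Rightarrow> real"
  assumes cont: "continuous_on UNIV f"
    and anti: "\<And>w x. w permutes UNIV \<Longrightarrow> f (perm_act w x) = of_int (sign w) * f x"
  shows "product_kernel_integral N UNIV (\<lambda>v. f (vec_lambda v)) (($) x) = sin_minus_partial_sum f N x"
proof -
  define I where "I = {m :: int ^ 'n::{finite,linorder}. \<forall>i. 1 \<le> m $ i \<and> m $ i \<le> int N}"
  have "finite I" unfolding I_def by (rule finite_int_vec_box)
  have [measurable]: "f \<in> borel_measurable borel"
    using cont by (rule borel_measurable_continuous_onI)
  have "(\<lambda>t :: real ^ 'n::{finite,linorder}. sine_kernel N s (t $ i)) \<in> borel_measurable borel" for s i
    by (rule measurable_compose[OF borel_measurable_continuous_onI measurable_sine_kernel])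
      (intro continuous_intros)
  then have meas: "(\<lambda>t. (\<Prod>i\<in>UNIV. sine_kernel N (x $ i) (t $ i)) * f t) \<in> borel_measurable borel"
    by (intro borel_measurable_times borel_measurable_prod) auto
  have "product_kernel_integral N UNIV (\<lambda>v. f (vec_lambda v)) (($) x)
      = (\<integral>v. (\<Prod>i\<in>UNIV. sine_kernel N (x $ i) (vec_lambda v $ i)) * f (vec_lambda v)
          \<partial>Pi\<^sub>M UNIV (\<lambda>_. lborel))"
    by (simp add: product_kernel_integral_def override_on_def)
  also have "\<dots> = (\<integral>t. (\<Prod>i\<in>UNIV. sine_kernel N (x $ i) (t $ i)) * f t \<partial>lborel)"
    unfolding lborel_eq_distr_vec_lambda
    by (rule integral_distr[symmetric, OF measurable_vec_lambda meas])
  also have "\<dots> = (\<integral>t. (\<Sum>m\<in>I. (4 ^ CARD('n) * sine_product m x)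
      * (indicator half_cube t * (f t * sine_product m t))) \<partial>lborel)"
    unfolding prod_sine_kernel_eq I_def[symmetric]
    by (simp add: sum_distrib_left sum_distrib_right mult_ac)
  also have "\<dots> = (\<Sum>m\<in>I. (4 ^ CARD('n) * sine_product m x)
      * (\<integral>t. indicator half_cube t * (f t * sine_product m t) \<partial>lborel))"
    by (subst Bochner_Integration.integral_sum)
      (auto intro!: integrable_mult_right integrable_indicator_times_continuous continuous_intros cont
        simp: half_cube_eq_cbox)
  also have "\<dots> = (\<Sum>m\<in>I. sin_minus_coeff f m * sine_product m x)"
  proof (rule sum.cong[OF refl])
    fix m
    have eq: "(\<integral>t. indicator half_cube t * (f t * sine_product m t) \<partial>lborel)
        = (LINT t:closure fund_domain|lborel. f t * sin_minus m t)"
      by (rule integral_half_cube_eq_fund_domain[OF cont anti])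
    show "(4 ^ CARD('n) * sine_product m x)
        * (\<integral>t. indicator half_cube t * (f t * sine_product m t) \<partial>lborel)
      = sin_minus_coeff f m * sine_product m x"
      unfolding eq sin_minus_coeff_def power_mult by simp
  qed
  also have "\<dots> = sin_minus_partial_sum f N x"
    unfolding I_def sin_minus_partial_sum_def
    by (intro sum_antisymmetric_times_sine_product sin_minus_coeff_permute_index sin_minus_coeff_eq_0)
  finally show ?thesis .
qed

section \<open>Coordinate slices and the uniform error bound\<close>

lemma int_periodic_continuous_bounded:
  fixes g :: "real ^ 'n::finite \<Rightarrow> real"
  assumes cont: "continuous_on UNIV g" and per: "\<And>x r. g (x + int_vec r) = g x"
  obtains B where "\<And>x. \<bar>g x\<bar> \<le> B"
proof -
  have "compact (g ` cbox 0 1)"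
    by (intro compact_continuous_image continuous_on_subset[OF cont]) auto
  then obtain B where B: "\<forall>y\<in>g ` cbox 0 1. \<bar>y\<bar> \<le> B"
    unfolding real_norm_def[symmetric] using compact_imp_bounded bounded_iff by metis
  have "\<bar>g x\<bar> \<le> B" for x
  proof -
    define r where "r = (\<chi> i. \<lfloor>x $ i\<rfloor>)"
    have "x - int_vec r \<in> cbox 0 1"
      by (auto simp: mem_box_cart int_vec_def r_def) linarith+
    then show ?thesis using B per[of "x - int_vec r" r] by auto
  qed
  then show ?thesis by (rule that)
qed

text \<open>Turns the partial derivative at a point into the derivative along a whole coordinate
  slice, in the form taken by the one-dimensional estimate.\<close>

lemma has_real_derivative_fun_upd:
  fixes f :: "real ^ 'n::finite \<Rightarrow> real"
  assumes "\<And>x. ((\<lambda>t. f (x + t *\<^sub>R axis i 1)) has_real_derivative D x) (at 0)"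
  shows "((\<lambda>t. f (vec_lambda (v(i := t)))) has_real_derivative D (vec_lambda (v(i := t)))) (at t)"
proof -
  have "vec_lambda (v(i := t)) + s *\<^sub>R axis i 1 = vec_lambda (v(i := s + t))" for s
    by (auto simp: vec_eq_iff axis_def)
  with assms[of "vec_lambda (v(i := t))"]
  have "((\<lambda>s. f (vec_lambda (v(i := s + t)))) has_real_derivative D (vec_lambda (v(i := t)))) (at 0)"
    by simp
  then show ?thesis
    using DERIV_shift[of "\<lambda>t. f (vec_lambda (v(i := t)))" "D (vec_lambda (v(i := t)))" 0 t] by simp
qed

lemma continuous_on_vec_lambda_fun_upd:
  "continuous_on A (\<lambda>t. vec_lambda (v(i := t)) :: real ^ 'n::finite)"
proof -
  have "continuous_on A (\<lambda>t. \<chi> j. if j = i then t else v j)"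
  proof (intro continuous_on_vec_lambda)
    show "continuous_on A (\<lambda>t. if j = i then t else v j)" for j
      by (cases "j = i") (auto intro: continuous_intros)
  qed
  then show ?thesis by (simp add: fun_upd_def)
qed

text \<open>Every coordinate slice is 1-periodic and odd, with derivative bounded independently of
  the slice, so the one-dimensional error bound holds with one constant and feeds the product
  estimate.\<close>

lemma sin_minus_partial_sum_uniform_error:
  fixes f :: "real ^ 'n::{finite,linorder} \<Rightarrow> real"
  assumes cont: "continuous_on UNIV f" and deriv: "continuous_partial_derivs f"
    and sym: "\<And>x w r. w permutes UNIV \<Longrightarrow> f (perm_act w x + int_vec r) = of_int (sign w) * f x"
    and odd: "\<And>x i. f (flip_coord i x) = - f x"
  obtains M where "\<And>N x. N \<ge> 1 \<Longrightarrow> \<bar>sin_minus_partial_sum f N x - f x\<bar>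
    \<le> M / sqrt (real N) * (\<Sum>k<CARD('n). (2 * ln (4 * real N + 3)) ^ k)"
proof -
  have id: "perm_act id x = x" for x :: "real ^ 'n::{finite,linorder}"
    by (simp add: perm_act_def)
  have per: "f (x + int_vec r) = f x" for x r
    using sym[of id x r] by (simp add: id permutes_id)
  have "int_vec 0 = (0 :: real ^ 'n::{finite,linorder})" by (simp add: int_vec_def vec_eq_iff)
  then have anti: "f (perm_act w x) = of_int (sign w) * f x" if "w permutes UNIV" for w x
    using sym[OF that, of x 0] by simp
  obtain D where contD: "\<And>i. continuous_on UNIV (D i)"
    and D: "\<And>i x. ((\<lambda>t. f (x + t *\<^sub>R axis i 1)) has_real_derivative D i x) (at 0)"
    using deriv unfolding continuous_partial_derivs_def by metis
  \<comment> \<open>A partial derivative inherits the periods of \<open>f\<close> by uniqueness of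
    derivatives, and is therefore bounded.\<close>
  have perD: "D i (x + int_vec r) = D i x" for i x r
  proof -
    have "x + int_vec r + t *\<^sub>R axis i 1 = (x + t *\<^sub>R axis i 1) + int_vec r" for t by simp
    then have "((\<lambda>t. f (x + t *\<^sub>R axis i 1)) has_real_derivative D i (x + int_vec r)) (at 0)"
      using D[of "x + int_vec r" i] by (simp only: per)
    then show ?thesis using D[of x i] by (rule DERIV_unique)
  qed
  have "\<exists>B. \<forall>x. \<bar>D i x\<bar> \<le> B" for i
    by (rule int_periodic_continuous_bounded[OF contD perD, of i]) blast
  then obtain B where B: "\<And>i x. \<bar>D i x\<bar> \<le> B i" by metis
  define M where "M = Max (range B)"
  have M: "\<bar>D i x\<bar> \<le> M" for i x
  proof -
    have "B i \<le> M" by (simp add: M_def)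
    with B[of i x] show ?thesis by linarith
  qed
  obtain C where C: "\<And>x. \<bar>f x\<bar> \<le> C"
    using int_periodic_continuous_bounded[OF cont per] by blast
  define F where "F v = f (vec_lambda v)" for v
  have "\<bar>sin_minus_partial_sum f N x - f x\<bar>
      \<le> M / sqrt (real N) * (\<Sum>k<CARD('n). (2 * ln (4 * real N + 3)) ^ k)" if "N \<ge> 1" for N x
  proof -
    have "\<bar>(\<integral>y. sine_kernel N (v i) y * F (v(i := y)) \<partial>lborel) - F v\<bar> \<le> M / sqrt (real N)" for v i
    proof -
      \<comment> \<open>The point value is written as the slice evaluated at \<open>v i\<close>, to
        match the form of \<open>sine_kernel_error\<close>.\<close>
      have "\<bar>(\<integral>y. sine_kernel N (v i) y * F (v(i := y)) \<partial>lborel) - F (v(i := v i))\<bar> \<le> M / sqrt (real N)"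
      proof (rule sine_kernel_error[where g' = "\<lambda>t. D i (vec_lambda (v(i := t)))"])
        show "((\<lambda>t. F (v(i := t))) has_real_derivative D i (vec_lambda (v(i := t)))) (at t)" for t
          unfolding F_def by (rule has_real_derivative_fun_upd) (rule D)
        show "continuous_on UNIV (\<lambda>t. D i (vec_lambda (v(i := t))))"
          by (rule continuous_on_compose2[OF contD continuous_on_vec_lambda_fun_upd]) simp
        show "\<bar>D i (vec_lambda (v(i := t)))\<bar> \<le> M" for t by (rule M)
        have "vec_lambda (v(i := t + 1)) = vec_lambda (v(i := t)) + int_vec (axis i 1)" for t
          by (auto simp: vec_eq_iff int_vec_def axis_def)
        then show "F (v(i := t + 1)) = F (v(i := t))" for t by (simp add: F_def per)
        have "vec_lambda (v(i := - t)) = flip_coord i (vec_lambda (v(i := t)))" for t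
          by (auto simp: vec_eq_iff flip_coord_def)
        then show "F (v(i := - t)) = - F (v(i := t))" for t by (simp add: F_def odd)
      qed fact
      then show ?thesis by simp
    qed
    moreover have "F \<in> borel_measurable (Pi\<^sub>M UNIV (\<lambda>_. lborel))"
      unfolding F_def
      by (rule measurable_compose[OF measurable_vec_lambda borel_measurable_continuous_onI[OF cont]])
    moreover have "\<bar>F v\<bar> \<le> C" for v by (simp add: F_def C)
    ultimately have "\<bar>product_kernel_integral N UNIV F (($) x) - F (($) x)\<bar>
        \<le> M / sqrt (real N) * (\<Sum>k<CARD('n). (2 * ln (4 * real N + 3)) ^ k)"
      by (intro product_kernel_integral_error) auto
    moreover have "product_kernel_integral N UNIV F (($) x) = sin_minus_partial_sum f N x"
      unfolding F_def by (rule product_kernel_integral_eq_partial_sum[OF cont anti])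
    ultimately show ?thesis by (simp add: F_def)
  qed
  then show ?thesis by (rule that)
qed

section \<open>Cubical and unordered summation\<close>

lemma finite_P_plus_box: "finite {m\<in>P_plus. \<forall>i. m $ i \<le> int N}"
  by (rule finite_subset[OF _ finite_int_vec_box[of N]])
    (auto simp: P_plus_def int_one_le_iff_zero_less)

text \<open>Every finite set of indices lies in some box, so an unordered sum, when it exists, is
  the limit of the cubical partial sums.\<close>

lemma filterlim_P_plus_box:
  "filterlim (\<lambda>N. {m\<in>(P_plus :: (int ^ 'n::{finite,linorder}) set). \<forall>i. m $ i \<le> int N})
     (finite_subsets_at_top P_plus) sequentially"
  unfolding filterlim_finite_subsets_at_top
proof (intro allI impI)
  fix X :: "(int ^ 'n::{finite,linorder}) set" assume X: "finite X \<and> X \<subseteq> P_plus"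
  define K where "K = Max (insert 0 ((\<lambda>(m, i). m $ i) ` (X \<times> UNIV)))"
  have "m $ i \<le> K" if "m \<in> X" for m i
    unfolding K_def using X that by (intro Max_ge) force+
  moreover have "K \<le> int N" if "N \<ge> nat K" for N using that by simp
  ultimately have "X \<subseteq> {m\<in>P_plus. \<forall>i. m $ i \<le> int N}" if "N \<ge> nat K" for N
    using that X by (blast intro: order.trans)
  then show "\<forall>\<^sub>F N in sequentially. finite {m\<in>P_plus. \<forall>i. m $ i \<le> int N} \<and>
      X \<subseteq> {m\<in>P_plus. \<forall>i. m $ i \<le> int N} \<and> {m\<in>P_plus. \<forall>i. m $ i \<le> int N} \<subseteq> P_plus"
    unfolding eventually_sequentially using finite_P_plus_box by blast
qed

text \<open>With nonnegative terms the cubical sums increase to \<open>S\<close>, which thus bounds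
  every finite sum and gives summability; cofinality of the boxes identifies the value.\<close>

lemma has_sum_P_plus_of_tendsto:
  fixes g :: "int ^ 'n::{finite,linorder} \<Rightarrow> real"
  assumes nonneg: "\<And>m. 0 \<le> g m"
    and lim: "(\<lambda>N. \<Sum>m\<in>{m\<in>P_plus. \<forall>i. m $ i \<le> int N}. g m) \<longlonglongrightarrow> S"
  shows "(g has_sum S) P_plus"
proof -
  let ?P = "\<lambda>N. {m\<in>(P_plus :: (int ^ 'n::{finite,linorder}) set). \<forall>i. m $ i \<le> int N}"
  have "incseq (\<lambda>N. \<Sum>m\<in>?P N. g m)"
  proof (rule incseq_SucI)
    fix N
    have "z \<le> int (Suc N)" if "z \<le> int N" for z using that by simp
    then have "?P N \<subseteq> ?P (Suc N)" by blast
    then show "(\<Sum>m\<in>?P N. g m) \<le> (\<Sum>m\<in>?P (Suc N). g m)"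
      by (intro sum_mono2 finite_P_plus_box nonneg)
  qed
  then have le: "(\<Sum>m\<in>?P N. g m) \<le> S" for N using lim by (rule incseq_le)
  have bound: "sum g X \<le> S" if "finite X" "X \<subseteq> P_plus" for X
  proof -
    from filterlim_P_plus_box[unfolded filterlim_finite_subsets_at_top, rule_format, OF conjI[OF that]]
    obtain N where "X \<subseteq> ?P N" unfolding eventually_sequentially by blast
    then have "sum g X \<le> sum g (?P N)" by (intro sum_mono2 finite_P_plus_box nonneg)
    with le show ?thesis by (meson order.trans)
  qed
  have "g summable_on P_plus"
  proof (intro nonneg_bdd_above_summable_on)
    show "bdd_above (sum g ` {X. X \<subseteq> P_plus \<and> finite X})"
      by (rule bdd_aboveI2[of _ _ S]) (simp add: bound)
  qed (rule nonneg)
  then obtain S' where S': "(g has_sum S') P_plus" unfolding summable_on_def ..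
  then have "(\<lambda>N. sum g (?P N)) \<longlonglongrightarrow> S'"
    unfolding has_sum_def by (rule filterlim_compose[OF _ filterlim_P_plus_box])
  then have "S' = S" using lim by (rule LIMSEQ_unique)
  with S' show ?thesis by simp
qed

theorem mainTheorem7:
  fixes f :: "real ^ 'n::{finite,linorder} \<Rightarrow> real"
  assumes "continuous_on UNIV f"
    and "continuous_partial_derivs f"
    and "\<And>x w r. w permutes UNIV \<Longrightarrow> f (perm_act w x + int_vec r) = of_int (sign w) * f x"
    and "\<And>x i. f (flip_coord i x) = - f x"
    and "\<And>x. x \<in> frontier (fund_domain :: (real ^ 'n::{finite,linorder}) set) \<Longrightarrow> f x = 0"
  shows "(\<forall>x. (\<lambda>N. sin_minus_partial_sum f N x) \<longlonglongrightarrow> f x) \<and>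
    ((\<lambda>m. \<bar>sin_minus_coeff f m\<bar>\<^sup>2) has_sum
       2 ^ (2 * CARD('n)) * (LINT x:closure fund_domain|lborel. \<bar>f x\<bar>\<^sup>2)) P_plus"
proof -
  obtain M where M: "\<And>N x. N \<ge> 1 \<Longrightarrow> \<bar>sin_minus_partial_sum f N x - f x\<bar>
      \<le> M / sqrt (real N) * (\<Sum>k<CARD('n). (2 * ln (4 * real N + 3)) ^ k)"
    using sin_minus_partial_sum_uniform_error[OF assms(1-4)] by blast
  \<comment> \<open>This error does not depend on the point, which later allows the limit to pass
    under the integral. It is used from \<open>N = 1\<close> on, as division by
    \<open>sqrt 0\<close> yields 0.\<close>
  define e where "e N = M / sqrt (real N) * (\<Sum>k<CARD('n). (2 * ln (4 * real N + 3)) ^ k)" for N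
  have err: "\<bar>sin_minus_partial_sum f N x - f x\<bar> \<le> e N" if "N \<ge> 1" for N x
    using M[OF that] by (simp add: e_def)
  have e: "e \<longlonglongrightarrow> 0" unfolding e_def by (rule error_bound_tendsto_0)
  have "(\<lambda>N. sin_minus_partial_sum f N x) \<longlonglongrightarrow> f x" for x
  proof (rule LIM_zero_cancel, rule Lim_null_comparison[OF _ e])
    show "\<forall>\<^sub>F N in sequentially. norm (sin_minus_partial_sum f N x - f x) \<le> e N"
      using err by (auto intro!: eventually_sequentiallyI[of 1])
  qed
  moreover have "((\<lambda>m. \<bar>sin_minus_coeff f m\<bar>\<^sup>2) has_sum
       2 ^ (2 * CARD('n)) * (LINT x:closure fund_domain|lborel. \<bar>f x\<bar>\<^sup>2)) P_plus"
  proof (rule has_sum_P_plus_of_tendsto)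
    let ?P = "\<lambda>N. {m\<in>(P_plus :: (int ^ 'n::{finite,linorder}) set). \<forall>i. m $ i \<le> int N}"
    define J where "J h = (\<integral>x. indicator (closure fund_domain) x * h x \<partial>lborel)"
      for h :: "real ^ 'n::{finite,linorder} \<Rightarrow> real"
    have int: "integrable lborel (\<lambda>x. indicator (closure fund_domain) x * h x)"
      if "continuous_on UNIV h" for h :: "real ^ 'n::{finite,linorder} \<Rightarrow> real"
      using that fund_domain_subset(1) by (intro integrable_indicator_times_continuous) auto
    have contS: "continuous_on UNIV (sin_minus_partial_sum f N)" for N
      unfolding sin_minus_partial_sum_def[abs_def] by (intro continuous_intros)
    \<comment> \<open>One factor of each squared coefficient is replaced by its defining integral;
      linearity then collects the terms into the partial sum.\<close>
    have sq: "(\<Sum>m\<in>?P N. \<bar>sin_minus_coeff f m\<bar>\<^sup>2)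
        = 2 ^ (2 * CARD('n)) * J (\<lambda>x. f x * sin_minus_partial_sum f N x)" for N
    proof -
      have "J (\<lambda>x. f x * sin_minus_partial_sum f N x) = (\<integral>x. (\<Sum>m\<in>?P N. sin_minus_coeff f m *
          (indicator (closure fund_domain) x * (f x * sin_minus m x))) \<partial>lborel)"
        by (simp add: J_def sin_minus_partial_sum_def sum_distrib_left mult_ac)
      also have "\<dots> = (\<Sum>m\<in>?P N. sin_minus_coeff f m * J (\<lambda>x. f x * sin_minus m x))"
        unfolding J_def
        by (subst Bochner_Integration.integral_sum)
          (auto intro!: integrable_mult_right int continuous_intros assms(1))
      finally show ?thesis
        by (simp add: sin_minus_coeff_def J_def set_lebesgue_integral_def sum_distrib_left
            power2_eq_square mult_ac)
    qed
    \<comment> \<open>The integrands differ by \<open>f\<close> times the error of the partial sum,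
      hence by at most |f| times \<open>e N\<close>.\<close>
    have "(\<lambda>N. J (\<lambda>x. f x * sin_minus_partial_sum f N x) - J (\<lambda>x. \<bar>f x\<bar>\<^sup>2)) \<longlonglongrightarrow> 0"
    proof (rule Lim_null_comparison)
      show "\<forall>\<^sub>F N in sequentially. norm (J (\<lambda>x. f x * sin_minus_partial_sum f N x) - J (\<lambda>x. \<bar>f x\<bar>\<^sup>2))
          \<le> J (\<lambda>x. \<bar>f x\<bar>) * e N"
      proof (rule eventually_sequentiallyI[of 1])
        fix N :: nat assume N: "1 \<le> N"
        let ?h = "\<lambda>x. f x * sin_minus_partial_sum f N x - \<bar>f x\<bar>\<^sup>2"
        have conth: "continuous_on UNIV ?h" by (intro continuous_intros assms(1) contS)
        have "J (\<lambda>x. f x * sin_minus_partial_sum f N x) - J (\<lambda>x. \<bar>f x\<bar>\<^sup>2) = J ?h"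
          unfolding J_def right_diff_distrib
          by (intro Bochner_Integration.integral_diff[symmetric] int continuous_intros assms(1) contS)
        also have "norm \<dots> \<le> (\<integral>x. indicator (closure fund_domain) x * \<bar>f x\<bar> * e N \<partial>lborel)"
          unfolding J_def
        proof (rule order.trans[OF integral_norm_bound integral_mono])
          show "integrable lborel (\<lambda>x. norm (indicator (closure fund_domain) x * ?h x))"
            by (intro integrable_norm int conth)
          show "integrable lborel (\<lambda>x. indicator (closure fund_domain) x * \<bar>f x\<bar> * e N)"
            by (intro integrable_mult_left int continuous_intros assms(1))
          fix x
          have "?h x = f x * (sin_minus_partial_sum f N x - f x)"
            by (simp add: power2_eq_square right_diff_distrib)
          then have "\<bar>?h x\<bar> \<le> \<bar>f x\<bar> * e N"
            using err[OF N, of x] by (simp add: abs_mult mult_left_mono)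
          then show "norm (indicator (closure fund_domain) x * ?h x)
              \<le> indicator (closure fund_domain) x * \<bar>f x\<bar> * e N"
            by (simp add: indicator_def)
        qed
        finally show "norm (J (\<lambda>x. f x * sin_minus_partial_sum f N x) - J (\<lambda>x. \<bar>f x\<bar>\<^sup>2))
            \<le> J (\<lambda>x. \<bar>f x\<bar>) * e N"
          by (simp add: J_def)
      qed
      show "(\<lambda>N. J (\<lambda>x. \<bar>f x\<bar>) * e N) \<longlonglongrightarrow> 0" using e by (rule tendsto_mult_right_zero)
    qed
    then have "(\<lambda>N. J (\<lambda>x. f x * sin_minus_partial_sum f N x)) \<longlonglongrightarrow> J (\<lambda>x. \<bar>f x\<bar>\<^sup>2)"
      by (rule LIM_zero_cancel)
    then show "(\<lambda>N. \<Sum>m\<in>?P N. \<bar>sin_minus_coeff f m\<bar>\<^sup>2) \<longlonglongrightarrow>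
        2 ^ (2 * CARD('n)) * (LINT x:closure fund_domain|lborel. \<bar>f x\<bar>\<^sup>2)"
      unfolding sq by (auto intro!: tendsto_intros simp: J_def set_lebesgue_integral_def)
  qed simp
  ultimately show ?thesis by blast
qed

end
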